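(* Let $\mathbf K$ be as in the context and let $\downarrow$ be a simple independence relation in $\mathbf K$ with the $(<\aleph_0)$-witness property for singletons. If $\mu,\lambda$ are cardinals with $\operatorname{LS}(\mathbf K)\le\mu\le\lambda$, $\kappa(\downarrow)\le\mu$ and $\mu^{<\ell(\downarrow)}=\mu$, then \[ NT(\mu,\lambda,(2^\mu)^+)\le\lambda^{\kappa(\downarrow)}+2^\mu. \]
   Context: $\mathbf{K}$ is an abstract elementary class (AEC) with strong substructure relation $\le_{\mathbf K}$ and Löwenheim–Skolem–Tarski number $\operatorname{LS}(\mathbf K)$, with joint embedding, amalgamation and no maximal models; we work in a monster model $\mathfrak C$. Galois-types $\mathbf{tp}(\mathbf b/A)$ are orbits of $\mathbf b$ under automorphisms of $\mathfrak C$ fixing $A$ pointwise; $\mathbf S^\alpha(M)$, $\mathbf S^\alpha(A)$ are the sets of Galois-types of length $\alpha$ over $M$, $A$; $\mathbf S(M)=\mathbf S^1(M)$, $\mathbf S^{<\infty}=\bigcup_\alpha\mathbf S^\alpha$. $\mathbf K_\lambda$ is the class of models of size $\lambda$. A set of Galois-types is consistent if a single $a\in\mathfrak C$ realizes all of them, otherwise inconsistent. An independence relation is a relation $A\downarrow_M B$ ($M\le_{\mathbf K}\mathfrak C$, $A,B\subseteq\mathfrak C$) satisfying: invariance under automorphisms of $\mathfrak C$; monotonicity; normality ($A\downarrow_MB$ iff $A\cup M\downarrow_MB\cup M$); base monotonicity (if $A\downarrow_MB$, $M\le_{\mathbf K}N$, $|N|\subseteq B$ then $A\downarrow_NB$);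 existence (every $p\in\mathbf S^{<\infty}(M)$ has, for each $N\ge_{\mathbf K}M$, an extension in $\mathbf S^{<\infty}(N)$ not forking over $M$); transitivity (if $M\le_{\mathbf K}N$, $A\downarrow_MN$, $A\downarrow_NB$ then $A\downarrow_MB$). "$\mathbf{tp}(\bar a/B)$ does not fork over $M$" means $\mathrm{ran}(\bar a)\downarrow_MB$. A simple independence relation additionally satisfies symmetry ($A\downarrow_MB$ iff $B\downarrow_MA$); type-amalgamation (if $p\in\mathbf S^{<\infty}(M)$, $M\subseteq A,B$, $A\downarrow_MB$, $N^*\in\mathbf K$ contains $A\cup B$, and $q_1\in\mathbf S^{<\infty}(A)$, $q_2\in\mathbf S^{<\infty}(B)$ both extend $p$ and do not fork over $M$, then some $q\in\mathbf S^{<\infty}(N^* )$ extends $q_1,q_2$ and does not fork over $M$); uniform local character (there are cardinals $\lambda,\theta$ such that every $p\in\mathbf S^\alpha(M)$ does not fork over some $M_0\le_{\mathbf K}M$ with $\|M_0\|\le\lambda+\alpha^{<\theta}$); $(\kappa(\downarrow),\ell(\downarrow))$ is the lexicographically least such pair $(\lambda,\theta)$. $\downarrow$ has the $(<\aleph_0)$-witness property for singletons if for all $M\le_{\mathbf K}N$ and $b\in\mathfrak C$: $b\downarrow_MN$ iff $b\downarrow_MA$ for every finite $A\subseteq N$. For $M\in\mathbf K$ and $\mu\le\|M\|$, $\mathbf S(M,\le\mu)=\{\mathbf{tp}(a/N):a\in\mathfrak C,\ N\le_{\mathbf K}M,\ \|N\|\le\mu\}$. For $\operatorname{LS}(\mathbf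 K)\le\mu\le\lambda$ and a cardinal $\kappa$, $NT(\mu,\lambda,\kappa)$ is the supremum of $|\Gamma|$ over all $\Gamma$ for which there is $M\in\mathbf K_\lambda$ with $\Gamma\subseteq\mathbf S(M,\le\mu)$ and every $\Delta\subseteq\Gamma$ with $|\Delta|\ge\kappa$ inconsistent.
   Formalization: The pair (κ(↓),ℓ(↓)) is taken lexicographically least among pairs with κ ≥ 1: if κ = 0 is allowed the bound fails, e.g. for nonempty pure sets with A∩B⊆M as independence and λ > 2^μ. As usual, λ is assumed below the (strong limit) size bound of the monster model. *)

theory Defs
  imports Main "HOL-Library.FuncSet"
begin

unbundle cardinal_syntax

definition is_card_sup :: "'b rel set \<Rightarrow> 'b rel \<Rightarrow> bool" where
  "is_card_sup R s \<longleftrightarrow> Card_order s \<and> (\<forall>r\<in>R. r \<le>o s) \<and>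
     (\<forall>t :: 'b rel. Card_order t \<and> (\<forall>r\<in>R. r \<le>o t) \<longrightarrow> s \<le>o t)"

definition card_sup :: "'b rel set \<Rightarrow> 'b rel" where
  "card_sup R = (SOME s. is_card_sup R s)"

lemma is_card_sup_card_sup:
  fixes R :: "'b rel set"
  assumes "\<And>r. r \<in> R \<Longrightarrow> Card_order r"
  shows "is_card_sup R (card_sup R)"
proof -
  let ?U = "{s :: 'b rel. Card_order s \<and> (\<forall>r\<in>R. r \<le>o s)}"
  have "r \<le>o |UNIV :: 'b set|" if "r \<in> R" for r
    using assms[OF that] card_of_Field_ordIso card_of_mono1 ordIso_ordLeq_trans ordIso_symmetric
    by (metis subset_UNIV)
  then have "|UNIV :: 'b set| \<in> ?U" by (simp add: card_of_Card_order)
  then have "?U \<noteq> {}" by blast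
  moreover have "\<forall>s\<in>?U. Card_order s" by simp
  ultimately obtain s where "s \<in> ?U" "\<forall>t\<in>?U. s \<le>o t"
    using exists_minim_Card_order[of ?U] by meson
  then have "is_card_sup R s" unfolding is_card_sup_def by simp
  then show ?thesis unfolding card_sup_def by (rule someI)
qed

text \<open>\<open>r\<close> to the power \<open>< t\<close>, that is, the supremum of \<open>r ^c s\<close> over the cardinals \<open>s <o t\<close>
  (so \<open>1\<close> to the power \<open>< t\<close> is \<open>1\<close> for \<open>t \<noteq> 0\<close>).\<close>

definition cexp_less :: "'b rel \<Rightarrow> 'a rel \<Rightarrow> ('a \<Rightarrow> 'b) rel" where
  "cexp_less r t = card_sup {r ^c s | s :: 'a rel. Card_order s \<and> s <o t}"

definition strong_limit :: "'a rel \<Rightarrow> bool" where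
  "strong_limit k \<longleftrightarrow> Card_order k \<and> cinfinite k \<and>
     (\<forall>s :: 'a rel. Card_order s \<and> s <o k \<longrightarrow> ctwo ^c s <o k)"

record ('f, 'r) language =
  funs :: "'f set"
  rels :: "'r set"
  fun_ar :: "'f \<Rightarrow> nat"
  rel_ar :: "'r \<Rightarrow> nat"

record ('f, 'r, 'a) struct =
  univ :: "'a set"
  fint :: "'f \<Rightarrow> 'a list \<Rightarrow> 'a"
  rint :: "'r \<Rightarrow> 'a list \<Rightarrow> bool"

definition tuples :: "'a set \<Rightarrow> nat \<Rightarrow> 'a list set" where
  "tuples A n = {xs. set xs \<subseteq> A \<and> length xs = n}"

text \<open>The interpretations carry no information outside the universe and the language, so that
  equality of structures in HOL is equality of structures.\<close>

definition is_struct :: "('f, 'r) language \<Rightarrow> ('f, 'r, 'a) struct \<Rightarrow> bool" where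
  "is_struct L M \<longleftrightarrow> univ M \<noteq> {} \<and>
     (\<forall>f xs. if f \<in> funs L \<and> xs \<in> tuples (univ M) (fun_ar L f)
             then fint M f xs \<in> univ M else fint M f xs = undefined) \<and>
     (\<forall>R xs. rint M R xs \<longrightarrow> R \<in> rels L \<and> xs \<in> tuples (univ M) (rel_ar L R))"

definition substruct ::
  "('f, 'r) language \<Rightarrow> ('f, 'r, 'a) struct \<Rightarrow> ('f, 'r, 'a) struct \<Rightarrow> bool" where
  "substruct L M N \<longleftrightarrow> is_struct L M \<and> is_struct L N \<and> univ M \<subseteq> univ N \<and>
     (\<forall>f\<in>funs L. \<forall>xs\<in>tuples (univ M) (fun_ar L f). fint M f xs = fint N f xs) \<and>
     (\<forall>R\<in>rels L. \<forall>xs\<in>tuples (univ M) (rel_ar L R). rint M R xs \<longleftrightarrow> rint N R xs)"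

definition is_iso ::
  "('f, 'r) language \<Rightarrow> ('a \<Rightarrow> 'a) \<Rightarrow> ('f, 'r, 'a) struct \<Rightarrow> ('f, 'r, 'a) struct \<Rightarrow> bool" where
  "is_iso L h M N \<longleftrightarrow> is_struct L M \<and> is_struct L N \<and> bij_betw h (univ M) (univ N) \<and>
     (\<forall>f\<in>funs L. \<forall>xs\<in>tuples (univ M) (fun_ar L f). h (fint M f xs) = fint N f (map h xs)) \<and>
     (\<forall>R\<in>rels L. \<forall>xs\<in>tuples (univ M) (rel_ar L R). rint M R xs \<longleftrightarrow> rint N R (map h xs))"

text \<open>All structures have their universe inside the type \<open>'a\<close>; a class of structures is thus
  represented by its members of size at most the size of \<open>'a\<close>, where \<open>'a\<close> is arbitrary.\<close>

record ('f, 'r, 'a) aec =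
  lang :: "('f, 'r) language"
  mods :: "('f, 'r, 'a) struct set"
  leK :: "('f, 'r, 'a) struct \<Rightarrow> ('f, 'r, 'a) struct \<Rightarrow> bool"

definition LST_bound :: "('f, 'r, 'a) aec \<Rightarrow> 'a rel \<Rightarrow> bool" where
  "LST_bound K r \<longleftrightarrow> Card_order r \<and> cinfinite r \<and>
     |funs (lang K)| +c |rels (lang K)| \<le>o r \<and>
     (\<forall>M\<in>mods K. \<forall>A. A \<subseteq> univ M \<longrightarrow>
        (\<exists>N. leK K N M \<and> A \<subseteq> univ N \<and> |univ N| \<le>o |A| +c r))"

definition is_LS :: "('f, 'r, 'a) aec \<Rightarrow> 'a rel \<Rightarrow> bool" where
  "is_LS K r \<longleftrightarrow> LST_bound K r \<and> (\<forall>s. LST_bound K s \<longrightarrow> r \<le>o s)"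

text \<open>In the two chain axioms \<open>U\<close> is the union of the chain \<open>\<C>\<close>: the only structure on
  the union of the universes that has every member of \<open>\<C>\<close> as a substructure. The increasing
  sequences indexed by ordinals are represented by their ranges.\<close>

definition chain_union ::
  "('f, 'r, 'a) aec \<Rightarrow> ('f, 'r, 'a) struct set \<Rightarrow> ('f, 'r, 'a) struct \<Rightarrow> bool" where
  "chain_union K \<C> U \<longleftrightarrow>
     \<C> \<noteq> {} \<and> \<C> \<subseteq> mods K \<and> well_order_on \<C> {(M, N). M \<in> \<C> \<and> N \<in> \<C> \<and> leK K M N} \<and>
     is_struct (lang K) U \<and> univ U = (\<Union>M\<in>\<C>. univ M) \<and> (\<forall>M\<in>\<C>. substruct (lang K) M U)"

definition AEC :: "('f, 'r, 'a) aec \<Rightarrow> bool" where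
  "AEC K \<longleftrightarrow>
     (\<forall>M\<in>mods K. is_struct (lang K) M) \<and>
     (\<forall>M N. leK K M N \<longrightarrow> M \<in> mods K \<and> N \<in> mods K \<and> substruct (lang K) M N) \<and>
     (\<forall>M\<in>mods K. leK K M M) \<and>
     (\<forall>M N P. leK K M N \<and> leK K N P \<longrightarrow> leK K M P) \<and>
     (\<forall>M N h. M \<in> mods K \<and> is_iso (lang K) h M N \<longrightarrow> N \<in> mods K) \<and>
     (\<forall>M N M' N' h. leK K M N \<and> is_iso (lang K) h N N' \<and> is_iso (lang K) h M M'
        \<longrightarrow> leK K M' N') \<and>
     (\<forall>M N P. leK K M P \<and> leK K N P \<and> substruct (lang K) M N \<longrightarrow> leK K M N) \<and>
     (\<forall>\<C> U. chain_union K \<C> U \<longrightarrow> U \<in> mods K \<and> (\<forall>M\<in>\<C>. leK K M U)) \<and>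
     (\<forall>\<C> U N. chain_union K \<C> U \<and> (\<forall>M\<in>\<C>. leK K M N) \<longrightarrow> leK K U N) \<and>
     (\<exists>r. LST_bound K r)"

definition K_embedding ::
  "('f, 'r, 'a) aec \<Rightarrow> ('a \<Rightarrow> 'a) \<Rightarrow> ('f, 'r, 'a) struct \<Rightarrow> ('f, 'r, 'a) struct \<Rightarrow> bool" where
  "K_embedding K h M N \<longleftrightarrow> (\<exists>N'. leK K N' N \<and> is_iso (lang K) h M N')"

definition joint_embedding :: "('f, 'r, 'a) aec \<Rightarrow> bool" where
  "joint_embedding K \<longleftrightarrow> (\<forall>M\<^sub>1\<in>mods K. \<forall>M\<^sub>2\<in>mods K. \<exists>N\<in>mods K. \<exists>h\<^sub>1 h\<^sub>2.
     K_embedding K h\<^sub>1 M\<^sub>1 N \<and> K_embedding K h\<^sub>2 M\<^sub>2 N)"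

definition amalgamation :: "('f, 'r, 'a) aec \<Rightarrow> bool" where
  "amalgamation K \<longleftrightarrow> (\<forall>M\<^sub>0 M\<^sub>1 M\<^sub>2. leK K M\<^sub>0 M\<^sub>1 \<and> leK K M\<^sub>0 M\<^sub>2 \<longrightarrow>
     (\<exists>N\<in>mods K. \<exists>h\<^sub>1 h\<^sub>2. K_embedding K h\<^sub>1 M\<^sub>1 N \<and> K_embedding K h\<^sub>2 M\<^sub>2 N \<and>
        (\<forall>x\<in>univ M\<^sub>0. h\<^sub>1 x = h\<^sub>2 x)))"

text \<open>The proper extension is taken up to isomorphism: a model whose universe is all of \<open>'a\<close>
  leaves no room for new elements.\<close>

definition no_maximal_models :: "('f, 'r, 'a) aec \<Rightarrow> bool" where
  "no_maximal_models K \<longleftrightarrow> (\<forall>M\<in>mods K. \<exists>N\<in>mods K. \<exists>h.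
     K_embedding K h M N \<and> h ` univ M \<noteq> univ N)"

text \<open>As usual, ``small'' means of size less than \<open>kbar\<close>, for a strong limit \<open>kbar\<close> above all cardinals
  under consideration. The monster model need not have size \<open>kbar\<close>.\<close>

definition monster :: "('f, 'r, 'a) aec \<Rightarrow> 'a rel \<Rightarrow> ('f, 'r, 'a) struct \<Rightarrow> bool" where
  "monster K kbar C \<longleftrightarrow> strong_limit kbar \<and> C \<in> mods K \<and>
     (\<forall>M\<in>mods K. |univ M| <o kbar \<longrightarrow> (\<exists>h. K_embedding K h M C)) \<and>
     (\<forall>M N h. leK K M C \<and> leK K N C \<and> |univ M| <o kbar \<and> is_iso (lang K) h M N \<longrightarrow>
        (\<exists>g. is_iso (lang K) g C C \<and> (\<forall>x\<in>univ M. g x = h x)))"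

definition small_model ::
  "('f, 'r, 'a) aec \<Rightarrow> 'a rel \<Rightarrow> ('f, 'r, 'a) struct \<Rightarrow> ('f, 'r, 'a) struct \<Rightarrow> bool" where
  "small_model K kbar C M \<longleftrightarrow> leK K M C \<and> |univ M| <o kbar"

definition small_set :: "'a rel \<Rightarrow> ('f, 'r, 'a) struct \<Rightarrow> 'a set \<Rightarrow> bool" where
  "small_set kbar C A \<longleftrightarrow> A \<subseteq> univ C \<and> |A| <o kbar"

text \<open>A type consists of its domain and an orbit of sequences. A sequence of length \<open>\<alpha>\<close>, for a
  well-order \<open>\<alpha>\<close>, is a function on \<open>Field \<alpha>\<close>.\<close>

type_synonym ('i, 'a) gtype = "'a set \<times> ('i \<Rightarrow> 'a) set"

definition gtp ::
  "('f, 'r, 'a) aec \<Rightarrow> ('f, 'r, 'a) struct \<Rightarrow> 'i set \<Rightarrow> ('i \<Rightarrow> 'a) \<Rightarrow> 'a set \<Rightarrow> ('i, 'a) gtype" where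
  "gtp K C I b A =
     (A, {restrict (g \<circ> b) I | g. is_iso (lang K) g C C \<and> (\<forall>a\<in>A. g a = a)})"

definition gS ::
  "('f, 'r, 'a) aec \<Rightarrow> ('f, 'r, 'a) struct \<Rightarrow> 'i rel \<Rightarrow> 'a set \<Rightarrow> ('i, 'a) gtype set" where
  "gS K C \<alpha> A = {gtp K C (Field \<alpha>) b A | b. b \<in> Field \<alpha> \<rightarrow> univ C}"

definition extends :: "('i, 'a) gtype \<Rightarrow> ('i, 'a) gtype \<Rightarrow> bool" where
  "extends q p \<longleftrightarrow> fst p \<subseteq> fst q \<and> snd q \<subseteq> snd p"

definition small_length :: "'a rel \<Rightarrow> 'a rel \<Rightarrow> bool" where
  "small_length kbar \<alpha> \<longleftrightarrow> Well_order \<alpha> \<and> |Field \<alpha>| <o kbar"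

text \<open>Types of elements are types of sequences of length 1, indexed by the type \<open>unit\<close>.\<close>

definition tp1 ::
  "('f, 'r, 'a) aec \<Rightarrow> ('f, 'r, 'a) struct \<Rightarrow> 'a \<Rightarrow> 'a set \<Rightarrow> (unit, 'a) gtype" where
  "tp1 K C a A = gtp K C UNIV (\<lambda>_. a) A"

definition realizes ::
  "('f, 'r, 'a) aec \<Rightarrow> ('f, 'r, 'a) struct \<Rightarrow> 'a \<Rightarrow> (unit, 'a) gtype \<Rightarrow> bool" where
  "realizes K C a p \<longleftrightarrow> p = tp1 K C a (fst p)"

definition consistent ::
  "('f, 'r, 'a) aec \<Rightarrow> ('f, 'r, 'a) struct \<Rightarrow> (unit, 'a) gtype set \<Rightarrow> bool" where
  "consistent K C \<Delta> \<longleftrightarrow> (\<exists>a\<in>univ C. \<forall>p\<in>\<Delta>. realizes K C a p)"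

text \<open>\<open>ind A M B\<close> stands for: \<open>A\<close> is independent from \<open>B\<close> over \<open>M\<close>.\<close>

type_synonym ('f, 'r, 'a) indrel = "'a set \<Rightarrow> ('f, 'r, 'a) struct \<Rightarrow> 'a set \<Rightarrow> bool"

definition does_not_fork ::
  "('f, 'r, 'a) aec \<Rightarrow> ('f, 'r, 'a) struct \<Rightarrow> ('f, 'r, 'a) indrel \<Rightarrow> 'i rel \<Rightarrow>
   ('i, 'a) gtype \<Rightarrow> ('f, 'r, 'a) struct \<Rightarrow> bool" where
  "does_not_fork K C ind \<alpha> p M \<longleftrightarrow>
     (\<exists>b \<in> Field \<alpha> \<rightarrow> univ C. p = gtp K C (Field \<alpha>) b (fst p) \<and> ind (b ` Field \<alpha>) M (fst p))"

definition ind_invariance ::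
  "('f, 'r, 'a) aec \<Rightarrow> 'a rel \<Rightarrow> ('f, 'r, 'a) struct \<Rightarrow> ('f, 'r, 'a) indrel \<Rightarrow> bool" where
  "ind_invariance K kbar C ind \<longleftrightarrow> (\<forall>g A M N B.
     is_iso (lang K) g C C \<and> small_model K kbar C M \<and> small_model K kbar C N \<and> is_iso (lang K) g M N \<and>
     small_set kbar C A \<and> small_set kbar C B \<and> ind A M B \<longrightarrow> ind (g ` A) N (g ` B))"

definition ind_monotonicity ::
  "('f, 'r, 'a) aec \<Rightarrow> 'a rel \<Rightarrow> ('f, 'r, 'a) struct \<Rightarrow> ('f, 'r, 'a) indrel \<Rightarrow> bool" where
  "ind_monotonicity K kbar C ind \<longleftrightarrow> (\<forall>A M B A' B'.
     small_model K kbar C M \<and> small_set kbar C A \<and> small_set kbar C B \<and>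
     ind A M B \<and> A' \<subseteq> A \<and> B' \<subseteq> B \<longrightarrow> ind A' M B')"

definition ind_normality ::
  "('f, 'r, 'a) aec \<Rightarrow> 'a rel \<Rightarrow> ('f, 'r, 'a) struct \<Rightarrow> ('f, 'r, 'a) indrel \<Rightarrow> bool" where
  "ind_normality K kbar C ind \<longleftrightarrow> (\<forall>A M B.
     small_model K kbar C M \<and> small_set kbar C A \<and> small_set kbar C B \<longrightarrow>
     (ind A M B \<longleftrightarrow> ind (A \<union> univ M) M (B \<union> univ M)))"

definition ind_base_monotonicity ::
  "('f, 'r, 'a) aec \<Rightarrow> 'a rel \<Rightarrow> ('f, 'r, 'a) struct \<Rightarrow> ('f, 'r, 'a) indrel \<Rightarrow> bool" where
  "ind_base_monotonicity K kbar C ind \<longleftrightarrow> (\<forall>A M N B.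
     small_model K kbar C M \<and> small_model K kbar C N \<and> small_set kbar C A \<and> small_set kbar C B \<and>
     ind A M B \<and> leK K M N \<and> univ N \<subseteq> B \<longrightarrow> ind A N B)"

definition ind_existence ::
  "('f, 'r, 'a) aec \<Rightarrow> 'a rel \<Rightarrow> ('f, 'r, 'a) struct \<Rightarrow> ('f, 'r, 'a) indrel \<Rightarrow> bool" where
  "ind_existence K kbar C ind \<longleftrightarrow> (\<forall>(\<alpha> :: 'a rel) M N. \<forall>p\<in>gS K C \<alpha> (univ M).
     small_length kbar \<alpha> \<and> small_model K kbar C M \<and> small_model K kbar C N \<and> leK K M N \<longrightarrow>
     (\<exists>q\<in>gS K C \<alpha> (univ N). extends q p \<and> does_not_fork K C ind \<alpha> q M))"

definition ind_transitivity ::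
  "('f, 'r, 'a) aec \<Rightarrow> 'a rel \<Rightarrow> ('f, 'r, 'a) struct \<Rightarrow> ('f, 'r, 'a) indrel \<Rightarrow> bool" where
  "ind_transitivity K kbar C ind \<longleftrightarrow> (\<forall>A M N B.
     small_model K kbar C M \<and> small_model K kbar C N \<and> small_set kbar C A \<and> small_set kbar C B \<and>
     leK K M N \<and> ind A M (univ N) \<and> ind A N B \<longrightarrow> ind A M B)"

definition independence_relation ::
  "('f, 'r, 'a) aec \<Rightarrow> 'a rel \<Rightarrow> ('f, 'r, 'a) struct \<Rightarrow> ('f, 'r, 'a) indrel \<Rightarrow> bool" where
  "independence_relation K kbar C ind \<longleftrightarrow>
     ind_invariance K kbar C ind \<and> ind_monotonicity K kbar C ind \<and> ind_normality K kbar C ind \<and>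
     ind_base_monotonicity K kbar C ind \<and> ind_existence K kbar C ind \<and> ind_transitivity K kbar C ind"

definition ind_symmetry ::
  "('f, 'r, 'a) aec \<Rightarrow> 'a rel \<Rightarrow> ('f, 'r, 'a) struct \<Rightarrow> ('f, 'r, 'a) indrel \<Rightarrow> bool" where
  "ind_symmetry K kbar C ind \<longleftrightarrow> (\<forall>A M B.
     small_model K kbar C M \<and> small_set kbar C A \<and> small_set kbar C B \<longrightarrow> (ind A M B \<longleftrightarrow> ind B M A))"

definition type_amalgamation ::
  "('f, 'r, 'a) aec \<Rightarrow> 'a rel \<Rightarrow> ('f, 'r, 'a) struct \<Rightarrow> ('f, 'r, 'a) indrel \<Rightarrow> bool" where
  "type_amalgamation K kbar C ind \<longleftrightarrow>
     (\<forall>(\<alpha> :: 'a rel) M A B N. \<forall>p\<in>gS K C \<alpha> (univ M). \<forall>q\<^sub>1\<in>gS K C \<alpha> A. \<forall>q\<^sub>2\<in>gS K C \<alpha> B.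
        small_length kbar \<alpha> \<and> small_model K kbar C M \<and> small_set kbar C A \<and> small_set kbar C B \<and>
        univ M \<subseteq> A \<and> univ M \<subseteq> B \<and> ind A M B \<and>
        small_model K kbar C N \<and> A \<union> B \<subseteq> univ N \<and>
        extends q\<^sub>1 p \<and> extends q\<^sub>2 p \<and>
        does_not_fork K C ind \<alpha> q\<^sub>1 M \<and> does_not_fork K C ind \<alpha> q\<^sub>2 M \<longrightarrow>
        (\<exists>q\<in>gS K C \<alpha> (univ N). extends q q\<^sub>1 \<and> extends q q\<^sub>2 \<and> does_not_fork K C ind \<alpha> q M))"

definition local_character_pair ::
  "('f, 'r, 'a) aec \<Rightarrow> 'a rel \<Rightarrow> ('f, 'r, 'a) struct \<Rightarrow> ('f, 'r, 'a) indrel \<Rightarrow>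
   'a rel \<Rightarrow> 'a rel \<Rightarrow> bool" where
  "local_character_pair K kbar C ind lam \<theta> \<longleftrightarrow>
     Card_order lam \<and> lam <o kbar \<and> Card_order \<theta> \<and> \<theta> <o kbar \<and>
     (\<forall>(\<alpha> :: 'a rel) M. \<forall>p\<in>gS K C \<alpha> (univ M).
        small_length kbar \<alpha> \<and> small_model K kbar C M \<longrightarrow>
        (\<exists>M\<^sub>0. leK K M\<^sub>0 M \<and> |univ M\<^sub>0| \<le>o lam +c cexp_less |Field \<alpha>| \<theta> \<and>
           does_not_fork K C ind \<alpha> p M\<^sub>0))"

definition simple_independence_relation ::
  "('f, 'r, 'a) aec \<Rightarrow> 'a rel \<Rightarrow> ('f, 'r, 'a) struct \<Rightarrow> ('f, 'r, 'a) indrel \<Rightarrow> bool" where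
  "simple_independence_relation K kbar C ind \<longleftrightarrow>
     independence_relation K kbar C ind \<and> ind_symmetry K kbar C ind \<and> type_amalgamation K kbar C ind \<and>
     (\<exists>lam \<theta>. local_character_pair K kbar C ind lam \<theta>)"

text \<open>The lexicographically least pair, among those whose first component is nonzero. The
  restriction matters because 1 to the power \<open>< \<theta>\<close> is 1: for pure sets, with \<open>A \<inter> B \<subseteq> M\<close> as
  independence, the pair \<open>(0, 2)\<close> has the local character property, although the types of \<open>a\<close>
  over \<open>{a}\<close>, for \<open>a\<close> in a model of size \<open>lam\<close>, are \<open>lam\<close> pairwise inconsistent types, more than
  \<open>lam ^c 0 +c ctwo ^c \<mu>\<close> when \<open>ctwo ^c \<mu> <o lam\<close>.\<close>

definition is_kappa_ell ::
  "('f, 'r, 'a) aec \<Rightarrow> 'a rel \<Rightarrow> ('f, 'r, 'a) struct \<Rightarrow> ('f, 'r, 'a) indrel \<Rightarrow>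
   'a rel \<Rightarrow> 'a rel \<Rightarrow> bool" where
  "is_kappa_ell K kbar C ind kap ell \<longleftrightarrow>
     local_character_pair K kbar C ind kap ell \<and> Field kap \<noteq> {} \<and>
     (\<forall>lam \<theta>. local_character_pair K kbar C ind lam \<theta> \<and> Field lam \<noteq> {} \<longrightarrow>
        kap <o lam \<or> (kap =o lam \<and> ell \<le>o \<theta>))"

definition finite_witness_singletons ::
  "('f, 'r, 'a) aec \<Rightarrow> 'a rel \<Rightarrow> ('f, 'r, 'a) struct \<Rightarrow> ('f, 'r, 'a) indrel \<Rightarrow> bool" where
  "finite_witness_singletons K kbar C ind \<longleftrightarrow>
     (\<forall>M N. \<forall>b\<in>univ C. small_model K kbar C M \<and> small_model K kbar C N \<and> leK K M N \<longrightarrow>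
        (ind {b} M (univ N) \<longleftrightarrow> (\<forall>A. finite A \<and> A \<subseteq> univ N \<longrightarrow> ind {b} M A)))"

definition S_le ::
  "('f, 'r, 'a) aec \<Rightarrow> ('f, 'r, 'a) struct \<Rightarrow> ('f, 'r, 'a) struct \<Rightarrow> 'a rel \<Rightarrow>
   (unit, 'a) gtype set" where
  "S_le K C M \<mu> = {tp1 K C a (univ N) | a N. a \<in> univ C \<and> leK K N M \<and> |univ N| \<le>o \<mu>}"

definition NT ::
  "('f, 'r, 'a) aec \<Rightarrow> ('f, 'r, 'a) struct \<Rightarrow> 'a rel \<Rightarrow> 'a rel \<Rightarrow> 'c rel \<Rightarrow>
   (unit, 'a) gtype rel" where
  "NT K C \<mu> lam \<chi> = card_sup {|\<Gamma>| | \<Gamma>. \<exists>M. leK K M C \<and> |univ M| =o lam \<and> \<Gamma> \<subseteq> S_le K C M \<mu> \<and>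
     (\<forall>\<Delta>\<subseteq>\<Gamma>. \<chi> \<le>o |\<Delta>| \<longrightarrow> \<not> consistent K C \<Delta>)}"

end

theory Submission
  imports Defs
begin

text \<open>Write \<open>\<chi>\<close> for \<open>2\<close> to the power \<open>\<mu>\<close>. By local character, every type \<open>tp(a/N)\<close> with
  \<open>N \<le> M\<close> and \<open>|N| \<le> \<mu>\<close> does not fork over a model of size at most \<open>\<kappa> + 1\<close> inside \<open>M\<close>, and there
  are at most \<open>\<lambda>\<close> to the power \<open>\<kappa>\<close> such models. So it suffices to bound by \<open>\<chi>\<close> every family \<open>G\<close> of
  such types that do not fork over one and the same model, if no more than \<open>\<chi>\<close> members of \<open>G\<close> are
  ever simultaneously realized.

  For a model \<open>R\<close> of size at most \<open>\<mu>\<close> and a type \<open>q\<close> over \<open>R\<close>, Zorn's lemma gives a maximal subset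
  of \<open>G\<close> that is realized by a nonforking extension of \<open>q\<close> to a model \<open>P(R, q)\<close> of size at most
  \<open>\<chi>\<close>; the finite witness property takes care of unions of chains. Since there are at most \<open>\<chi>\<close>
  types over \<open>R\<close>, there is a model \<open>W\<close> of size at most \<open>\<chi>\<close> that contains \<open>P(R, q)\<close> whenever it
  contains \<open>R\<close>. By local character, the domain of any member of \<open>G\<close> is independent from \<open>W\<close> over
  some such \<open>R\<close>, and type amalgamation over \<open>R\<close> puts this member into one of the maximal sets.
  Since \<open>W\<close> has at most \<open>\<chi>\<close> subsets of size at most \<open>\<mu>\<close>, there are no more than \<open>\<chi>\<close> members.\<close>

section \<open>Cardinals\<close>

lemma subset_chain_cofinal_wellorder:
  assumes chain: "subset.chain \<A> \<C>" and ne: "\<C> \<noteq> {}"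
  obtains \<D> where "\<D> \<subseteq> \<C>" "\<D> \<noteq> {}" "\<Union>\<D> = \<Union>\<C>"
    "well_order_on \<D> {(A, B). A \<in> \<D> \<and> B \<in> \<D> \<and> A \<subseteq> B}"
proof -
  obtain r where r: "well_order_on \<C> r" using well_order_on by blast
  then have wf: "wf (r - Id)" by (simp add: well_order_on_def)
  have total: "(A, B) \<in> r \<or> (B, A) \<in> r" if "A \<in> \<C>" "B \<in> \<C>" "A \<noteq> B" for A B
    using r that unfolding well_order_on_def linear_order_on_def total_on_def by blast
  define \<D> where "\<D> = {A \<in> \<C>. \<forall>B\<in>\<C>. (B, A) \<in> r - Id \<longrightarrow> B \<subset> A}"
  let ?incl = "{(A, B). A \<in> \<D> \<and> B \<in> \<D> \<and> A \<subseteq> B}"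
  have sub: "\<D> \<subseteq> \<C>" unfolding \<D>_def by blast
  have cofinal: "\<exists>B\<in>\<D>. A \<subseteq> B" if A: "A \<in> \<C>" for A
  proof -
    obtain B where B: "B \<in> {B \<in> \<C>. A \<subseteq> B}"
      and min: "\<And>D. (D, B) \<in> r - Id \<Longrightarrow> D \<notin> {B \<in> \<C>. A \<subseteq> B}"
      using wfE_min[OF wf, of A "{B \<in> \<C>. A \<subseteq> B}"] A by auto
    have "D \<subset> B" if "D \<in> \<C>" "(D, B) \<in> r - Id" for D
      using min[OF that(2)] that(1) subset.chain_total[OF chain that(1) A] B by blast
    then show ?thesis using B unfolding \<D>_def by blast
  qed
  have "?incl - Id \<subseteq> r - Id"
  proof (rule subrelI)
    fix A B assume "(A, B) \<in> ?incl - Id"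
    then have AB: "A \<in> \<D>" "B \<in> \<D>" "A \<subseteq> B" "A \<noteq> B" by auto
    then have "(B, A) \<notin> r" unfolding \<D>_def by blast
    then show "(A, B) \<in> r - Id" using total[of A B] AB sub by blast
  qed
  then have "wf (?incl - Id)" by (rule wf_subset[OF wf])
  then have "well_order_on \<D> ?incl"
    unfolding well_order_on_def linear_order_on_def partial_order_on_def preorder_on_def
      refl_on_def total_on_def antisym_def trans_def
    using subset.chain_total[OF chain] sub by blast
  moreover have "\<D> \<noteq> {}" "\<Union>\<D> = \<Union>\<C>" using ne sub cofinal by blast+
  ultimately show ?thesis using that sub by blast
qed

lemma subset_chain_image:
  assumes chain: "subset.chain \<A> \<C>"
    and f: "\<And>A B. A \<subseteq> B \<Longrightarrow> f A \<subseteq> f B" "\<And>A. A \<in> \<C> \<Longrightarrow> f A \<in> \<B>"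
  shows "subset.chain \<B> (f ` \<C>)"
  unfolding subset_chain_def
proof (intro conjI ballI)
  fix X Y assume "X \<in> f ` \<C>" "Y \<in> f ` \<C>"
  then obtain A B where "A \<in> \<C>" "B \<in> \<C>" and X: "X = f A" and Y: "Y = f B" by blast
  then have "A \<subseteq> B \<or> B \<subseteq> A" using chain unfolding subset_chain_def by blast
  then show "X \<subseteq> Y \<or> Y \<subseteq> X" unfolding X Y using f(1) by blast
qed (use f(2) in blast)

lemma Card_order_ordLeq_or_ordLess:
  assumes "Card_order r" "Card_order s"
  shows "r \<le>o s \<or> s <o r"
  using assms[THEN card_order_on_well_order_on] ordLess_or_ordLeq by blast

lemma Card_order_internalize:
  assumes t: "Card_order t" "t \<le>o |A|"
  obtains B where "B \<subseteq> A" "t =o |B|"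
proof -
  have "|Field t| \<le>o |A|"
    using card_of_Field_ordIso[OF t(1)] t(2) ordIso_ordLeq_trans by blast
  then obtain B where "B \<subseteq> A" "|Field t| =o |B|"
    using internalize_card_of_ordLeq2[of "Field t" A] by blast
  then show ?thesis
    using that card_of_Field_ordIso[OF t(1)] ordIso_symmetric ordIso_transitive by blast
qed

lemma Card_order_ordLeq_UNIV:
  fixes r :: "'b rel"
  assumes "Card_order r"
  shows "r \<le>o |UNIV :: 'b set|"
  using card_of_Field_ordIso[OF assms] card_of_mono1[OF subset_UNIV] ordIso_symmetric
    ordIso_ordLeq_trans by blast

text \<open>By definition \<open>card_sup R\<close> is least only among the upper bounds on its own type.\<close>

lemma card_sup_ordLeq:
  fixes R :: "'b rel set" and t :: "'c rel"
  assumes R: "\<And>r. r \<in> R \<Longrightarrow> Card_order r" and upper: "\<And>r. r \<in> R \<Longrightarrow> r \<le>o t" and t: "Card_order t"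
  shows "card_sup R \<le>o t"
proof -
  have sup: "is_card_sup R (card_sup R)" by (rule is_card_sup_card_sup[OF R])
  consider "t \<le>o |UNIV :: 'b set|" | "|UNIV :: 'b set| \<le>o t"
    using Card_order_ordLeq_or_ordLess[OF t card_of_Card_order] ordLess_imp_ordLeq by blast
  then show ?thesis
  proof cases
    case 1
    then obtain B :: "'b set" where B: "t =o |B|" using Card_order_internalize[OF t] by blast
    then have "\<forall>r\<in>R. r \<le>o |B|" using upper ordLeq_ordIso_trans by blast
    then have "card_sup R \<le>o |B|" using sup card_of_Card_order unfolding is_card_sup_def by blast
    then show ?thesis using B ordIso_symmetric ordLeq_ordIso_trans by blast
  next
    case 2
    have "card_sup R \<le>o |UNIV :: 'b set|"
      using sup Card_order_ordLeq_UNIV unfolding is_card_sup_def by blast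
    then show ?thesis using 2 ordLeq_transitive by blast
  qed
qed

lemma is_card_sup_cexp_less:
  fixes t :: "'a rel"
  shows "is_card_sup {r ^c s |s :: 'a rel. Card_order s \<and> s <o t} (cexp_less r t)"
  unfolding cexp_less_def by (rule is_card_sup_card_sup) (auto simp: Card_order_cexp)

lemma Card_order_cexp_less: "Card_order (cexp_less r t)"
  using is_card_sup_cexp_less unfolding is_card_sup_def by blast

lemma cexp_ordLeq_cexp_less:
  fixes s t :: "'a rel"
  shows "Card_order s \<Longrightarrow> s <o t \<Longrightarrow> r ^c s \<le>o cexp_less r t"
  using is_card_sup_cexp_less[of r t] unfolding is_card_sup_def by blast

lemma cexp_less_mono1:
  assumes "r \<le>o r'"
  shows "cexp_less r t \<le>o cexp_less r' t"
  using cexp_mono1[OF assms] cexp_ordLeq_cexp_less ordLeq_transitive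
  by (subst cexp_less_def) (fast intro!: card_sup_ordLeq Card_order_cexp Card_order_cexp_less)

lemma cexp_less_singleton:
  fixes t :: "'a rel"
  shows "cexp_less |{x}| t \<le>o cone"
proof -
  have "|{x}| ^c s \<le>o cone" for s :: "'a rel"
  proof -
    have "|Func (Field s) {x}| \<le>o |{()}|"
      by (rule card_of_ordLeqI[of "\<lambda>_. ()"]) (auto simp: inj_on_def Func_def fun_eq_iff, metis)
    then show ?thesis by (simp add: cexp_def cone_def Field_card_of)
  qed
  then show ?thesis
    unfolding cexp_less_def by (auto intro!: card_sup_ordLeq Card_order_cexp Card_order_cone)
qed

lemma cexp_cexp_same:
  assumes k: "Cinfinite k" and r: "Card_order r"
  shows "(r ^c k) ^c k =o r ^c k"
proof -
  have "(r ^c k) ^c k =o r ^c (k *c k)" using cexp_cprod[OF r] .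
  also have "r ^c (k *c k) =o r ^c k"
    using cexp_cong2[OF cprod_infinite[OF k] r Card_order_cprod] .
  finally show ?thesis .
qed

lemma cexp_ctwo_ordLeq:
  assumes r: "Cinfinite r"
  shows "r ^c ctwo \<le>o r"
proof -
  have "|Func (UNIV :: bool set) (Field r)| \<le>o |Field r \<times> Field r|"
    by (rule card_of_ordLeqI[of "\<lambda>f. (f True, f False)"])
      (auto simp: inj_on_def Func_def fun_eq_iff, metis (full_types))
  also have "|Field r \<times> Field r| =o r"
    using cprod_infinite[OF r] unfolding cprod_def .
  finally show ?thesis by (simp add: cexp_def ctwo_def Field_card_of)
qed

lemma cexp_csum_cone:
  assumes r: "Cinfinite r" and k: "Card_order k" "Field k \<noteq> {}"
  shows "r ^c (k +c cone) \<le>o r ^c k"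
proof -
  have "cone \<le>o k" using cone_ordLeq_Cnotzero k czeroE by blast
  then have "k +c cone \<le>o k +c k" by (rule csum_mono2)
  also have "k +c k =o |Field k \<times> (UNIV :: bool set)|"
    unfolding csum_def by (rule card_of_Plus_Times_bool)
  also have "|Field k \<times> (UNIV :: bool set)| =o ctwo *c k"
    unfolding cprod_def ctwo_def Field_card_of by (rule card_of_Times_commute)
  finally have "r ^c (k +c cone) \<le>o r ^c (ctwo *c k)"
    by (rule cexp_mono2') (use r k(2) in \<open>auto simp: Field_csum\<close>)
  also have "r ^c (ctwo *c k) =o (r ^c ctwo) ^c k"
    using cexp_cprod r ordIso_symmetric by blast
  also have "(r ^c ctwo) ^c k \<le>o r ^c k"
    by (rule cexp_mono1[OF cexp_ctwo_ordLeq[OF r] k(1)])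
  finally show ?thesis .
qed

lemma card_of_Pow_ordLeq:
  assumes A: "|A| \<le>o r" and r: "Card_order r"
  shows "|Pow A| \<le>o ctwo ^c r"
proof -
  have "|A| \<le>o |Field r|"
    using A card_of_Field_ordIso[OF r] ordIso_symmetric ordLeq_ordIso_trans by blast
  then obtain f where f: "inj_on f A" "f ` A \<subseteq> Field r"
    using card_of_ordLeq[of A "Field r"] by blast
  have "|Pow A| \<le>o |Pow (Field r)|"
    by (rule card_of_ordLeqI[OF inj_on_image_Pow[OF f(1)]]) (use f(2) in blast)
  also have "|Pow (Field r)| =o ctwo ^c r"
    using card_of_Pow_Func by (simp add: cexp_def ctwo_def Field_card_of)
  finally show ?thesis .
qed

lemma card_of_image_if_determined:
  assumes "\<And>x y. x \<in> A \<Longrightarrow> y \<in> A \<Longrightarrow> f x = f y \<Longrightarrow> g x = g y"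
  shows "|g ` A| \<le>o |f ` A|"
proof (rule surj_imp_ordLeq)
  show "g ` A \<subseteq> (\<lambda>y. g (inv_into A f y)) ` f ` A"
  proof (rule image_subsetI)
    fix x assume x: "x \<in> A"
    then have "g x = g (inv_into A f (f x))"
      using assms[OF x inv_into_into[of "f x" f A]] f_inv_into_f[of "f x" f A] by simp
    then show "g x \<in> (\<lambda>y. g (inv_into A f y)) ` f ` A" using x by blast
  qed
qed

lemma subset_of_card_cardSuc:
  assumes r: "Card_order r" and A: "\<not> |A| \<le>o r"
  obtains B where "B \<subseteq> A" "|B| =o cardSuc r"
proof -
  have "r <o |A|" using Card_order_ordLeq_or_ordLess[OF card_of_Card_order r] A by blast
  then have "cardSuc r \<le>o |A|" using cardSuc_least[OF r card_of_Card_order] by blast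
  then obtain B where "B \<subseteq> A" "cardSuc r =o |B|"
    using Card_order_internalize[OF cardSuc_Card_order[OF r]] by blast
  then show ?thesis using that ordIso_symmetric by blast
qed

lemma strong_limit_cardSuc:
  assumes k: "strong_limit k" and r: "Card_order r" "r <o k"
  shows "cardSuc r <o k"
proof -
  have "Card_order k" using k unfolding strong_limit_def by blast
  then have "r \<le>o |Field k|"
    using r(2) card_of_Field_ordIso ordIso_symmetric ordLess_ordIso_trans ordLess_imp_ordLeq
    by blast
  then obtain B where B: "B \<subseteq> Field k" "r =o |B|" using Card_order_internalize[OF r(1)] by blast
  have "r <o ctwo ^c |B|"
    using B(2) ordLess_ctwo_cexp[OF card_of_Card_order] ordIso_ordLess_trans by blast
  then have "cardSuc r \<le>o ctwo ^c |B|" using cardSuc_least r(1) Card_order_cexp by blast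
  moreover have "|B| <o k" using B(2) r(2) ordIso_symmetric ordIso_ordLess_trans by blast
  then have "ctwo ^c |B| <o k" using k card_of_Card_order unfolding strong_limit_def by blast
  ultimately show ?thesis using ordLeq_ordLess_trans by blast
qed

text \<open>The empty set is left out because it is not the image of a sequence of length \<open>k\<close>.\<close>

definition subsets_upto :: "'k rel \<Rightarrow> 'b set \<Rightarrow> 'b set set" where
  "subsets_upto k X = {A. A \<subseteq> X \<and> A \<noteq> {} \<and> |A| \<le>o k}"

lemma subsets_upto_mono: "X \<subseteq> Y \<Longrightarrow> subsets_upto k X \<subseteq> subsets_upto k Y"
  unfolding subsets_upto_def by blast

lemma card_of_subsets_upto:
  assumes k: "Card_order k"
  shows "|subsets_upto k X| \<le>o |X| ^c k"
proof -
  have "subsets_upto k X \<subseteq> (\<lambda>f. f ` Field k) ` Func (Field k) X"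
  proof
    fix A assume "A \<in> subsets_upto k X"
    then have A: "A \<subseteq> X" "A \<noteq> {}" "|A| \<le>o k" unfolding subsets_upto_def by auto
    then have "|A| \<le>o |Field k|"
      using card_of_Field_ordIso[OF k] ordIso_symmetric ordLeq_ordIso_trans by blast
    then obtain f where f: "f ` Field k = A" using card_of_ordLeq2[OF A(2), of "Field k"] by metis
    let ?g = "\<lambda>x. if x \<in> Field k then f x else undefined"
    have "?g \<in> Func (Field k) X" using f A(1) by (auto simp: Func_def)
    moreover have "?g ` Field k = A" using f by auto
    ultimately show "A \<in> (\<lambda>f. f ` Field k) ` Func (Field k) X" by blast
  qed
  from surj_imp_ordLeq[OF this] show ?thesis by (simp add: cexp_def Field_card_of)
qed

lemma card_of_subsets_upto_bound:
  assumes "|X| \<le>o r" "r ^c k \<le>o r" "Card_order k"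
  shows "|subsets_upto k X| \<le>o r"
  by (rule ordLeq_transitive[OF card_of_subsets_upto[OF assms(3)]
        ordLeq_transitive[OF cexp_mono1[OF assms(1,3)] assms(2)]])

lemma card_of_UN_subsets_upto_bound:
  assumes "|X| \<le>o r" "Cinfinite r" "r ^c k \<le>o r" "Card_order k"
    and "I \<subseteq> subsets_upto k X" "\<And>A. A \<in> I \<Longrightarrow> |F A| \<le>o r"
  shows "|\<Union>A\<in>I. F A| \<le>o r"
proof (rule UNION_Cinfinite_bound)
  show "|I| \<le>o r"
    using card_of_mono1[OF assms(5)] card_of_subsets_upto_bound[OF assms(1,3,4)] ordLeq_transitive
    by blast
qed (use assms in auto)

lemma ordLess_if_cexp_ordLeq:
  assumes "r ^c k \<le>o r" "Cinfinite r" "Card_order k"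
  shows "k <o r"
proof -
  have "k <o ctwo ^c k" using ordLess_ctwo_cexp assms(3) by blast
  also have "ctwo ^c k \<le>o r ^c k" using cexp_mono1 ctwo_ordLeq_Cinfinite assms(2,3) by blast
  also have "r ^c k \<le>o r" by (rule assms(1))
  finally show ?thesis .
qed

lemma increasing_chain_exists:
  fixes r :: "'i rel" and step :: "'x set \<Rightarrow> 'x set"
  assumes r: "Well_order r" "|Field r| \<le>o \<chi>" and \<chi>: "Cinfinite \<chi>"
    and cover: "\<And>A. A \<subseteq> \<Union>Q \<Longrightarrow> |A| \<le>o \<chi> \<Longrightarrow> \<exists>B\<in>Q. A \<subseteq> B \<and> |B| \<le>o \<chi>"
    and step: "\<And>A. A \<subseteq> \<Union>Q \<Longrightarrow> |A| \<le>o \<chi> \<Longrightarrow> step A \<subseteq> \<Union>Q \<and> |step A| \<le>o \<chi>"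
  shows "\<exists>As. \<forall>i. As i \<in> Q \<and> |As i| \<le>o \<chi> \<and> (\<forall>j\<in>underS r i. step (As j) \<subseteq> As i)"
proof (rule dependent_wf_choice)
  show "wf (r - Id)" using r(1) by (simp add: well_order_on_def)
next
  fix As :: "'i \<Rightarrow> 'x set" and i
  assume "\<And>j. (j, i) \<in> r - Id \<Longrightarrow>
    As j \<in> Q \<and> |As j| \<le>o \<chi> \<and> (\<forall>l\<in>underS r j. step (As l) \<subseteq> As j)"
  then have below: "As j \<in> Q" "|As j| \<le>o \<chi>" if "j \<in> underS r i" for j
    using that unfolding underS_def by blast+
  then have "As j \<subseteq> \<Union>Q" if "j \<in> underS r i" for j using that by blast
  then have steps: "step (As j) \<subseteq> \<Union>Q" "|step (As j)| \<le>o \<chi>" if "j \<in> underS r i" for j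
    using step below that by blast+
  have "|underS r i| \<le>o |Field r|" by (intro card_of_mono1) (auto simp: underS_def Field_def)
  then have "|underS r i| \<le>o \<chi>" using r(2) ordLeq_transitive by blast
  then have "|\<Union>j\<in>underS r i. step (As j)| \<le>o \<chi>"
    using UNION_Cinfinite_bound[of "underS r i" \<chi> "\<lambda>j. step (As j)"] \<chi> steps(2) by blast
  moreover have "(\<Union>j\<in>underS r i. step (As j)) \<subseteq> \<Union>Q" using steps(1) by (rule UN_least)
  ultimately obtain B where "B \<in> Q" "(\<Union>j\<in>underS r i. step (As j)) \<subseteq> B" "|B| \<le>o \<chi>"
    using cover by meson
  then show "\<exists>B. B \<in> Q \<and> |B| \<le>o \<chi> \<and> (\<forall>j\<in>underS r i. step (As j) \<subseteq> B)" by blast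
qed (auto simp: underS_def)

definition closure_step :: "'k rel \<Rightarrow> ('x set \<Rightarrow> 'x set) \<Rightarrow> 'x set \<Rightarrow> 'x set \<Rightarrow> 'x set" where
  "closure_step k F A0 A = A \<union> A0 \<union> (\<Union>R\<in>subsets_upto k A. F R)"

lemma closure_step_bound:
  assumes \<mu>: "Card_order \<mu>" and \<chi>: "Cinfinite \<chi>" "\<chi> ^c \<mu> \<le>o \<chi>"
    and F: "\<And>R. R \<in> subsets_upto \<mu> U \<Longrightarrow> F R \<subseteq> U \<and> |F R| \<le>o \<chi>"
    and A0: "A0 \<subseteq> U" "|A0| \<le>o \<chi>" and A: "A \<subseteq> U" "|A| \<le>o \<chi>"
  shows "closure_step \<mu> F A0 A \<subseteq> U \<and> |closure_step \<mu> F A0 A| \<le>o \<chi>"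
proof -
  have FR: "F R \<subseteq> U \<and> |F R| \<le>o \<chi>" if "R \<in> subsets_upto \<mu> A" for R
    using F subsets_upto_mono[OF A(1)] that by blast
  then have "|closure_step \<mu> F A0 A| \<le>o \<chi>"
    unfolding closure_step_def
    by (intro Un_Cinfinite_bound card_of_UN_subsets_upto_bound[OF A(2) \<chi> \<mu>] A(2) A0(2) \<chi>(1)) auto
  moreover have "closure_step \<mu> F A0 A \<subseteq> U"
    unfolding closure_step_def using A(1) A0(1) FR by blast
  ultimately show ?thesis by blast
qed

text \<open>The closure is the union of a chain of length \<open>cardSuc \<mu>\<close>: a subset of size at most \<open>\<mu>\<close> is
  contained in a member of the chain, since \<open>cardSuc \<mu>\<close> is regular.\<close>

lemma closed_superset_exists:
  fixes F :: "'x set \<Rightarrow> 'x set"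
  assumes \<mu>: "Cinfinite \<mu>" and \<chi>: "Cinfinite \<chi>" "\<chi> ^c \<mu> \<le>o \<chi>"
    and Union_chain: "\<And>\<C>. subset.chain Q \<C> \<Longrightarrow> \<C> \<noteq> {} \<Longrightarrow> \<Union>\<C> \<in> Q"
    and cover: "\<And>A. A \<subseteq> \<Union>Q \<Longrightarrow> |A| \<le>o \<chi> \<Longrightarrow> \<exists>B\<in>Q. A \<subseteq> B \<and> |B| \<le>o \<chi>"
    and F: "\<And>R. R \<in> subsets_upto \<mu> (\<Union>Q) \<Longrightarrow> F R \<subseteq> \<Union>Q \<and> |F R| \<le>o \<chi>"
    and A0: "A0 \<subseteq> \<Union>Q" "|A0| \<le>o \<chi>"
  obtains W where "W \<in> Q" "A0 \<subseteq> W" "|W| \<le>o \<chi>" "\<And>R. R \<in> subsets_upto \<mu> W \<Longrightarrow> F R \<subseteq> W"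
proof -
  let ?r = "cardSuc \<mu>"
  have r: "Card_order ?r" "Cinfinite ?r" "?r \<le>o \<chi>"
    using cardSuc_Card_order Cinfinite_cardSuc cardSuc_least ordLess_if_cexp_ordLeq \<mu> \<chi> by blast+
  have wo: "Well_order ?r" and card_r: "|Field ?r| \<le>o \<chi>"
    using r card_order_on_well_order_on card_of_Field_ordIso ordIso_ordLeq_trans by blast+
  let ?step = "closure_step \<mu> F A0"
  have step: "?step A \<subseteq> \<Union>Q \<and> |?step A| \<le>o \<chi>" if "A \<subseteq> \<Union>Q" "|A| \<le>o \<chi>" for A
    using closure_step_bound[of \<mu> \<chi> "\<Union>Q" F A0 A] \<mu> \<chi> F A0 that by blast
  obtain As where As: "\<And>i. As i \<in> Q" "\<And>i. |As i| \<le>o \<chi>"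
    and "\<forall>i. \<forall>j\<in>underS ?r i. ?step (As j) \<subseteq> As i"
    using increasing_chain_exists[of ?r \<chi> Q ?step, OF wo card_r \<chi>(1) cover step] by blast
  then have step_le: "?step (As i) \<subseteq> As j" if "(i, j) \<in> ?r" "i \<noteq> j" for i j
    using that unfolding underS_def by blast
  have step_in: "?step (As i) \<subseteq> (\<Union>j\<in>Field ?r. As j)" if "i \<in> Field ?r" for i
    using infinite_Card_order_limit[OF r(1) _ that] r(2) step_le unfolding cinfinite_def by blast
  have incr: "relChain ?r As"
    unfolding relChain_def using step_le unfolding closure_step_def by blast
  have ne: "Field ?r \<noteq> {}" using r(2) unfolding cinfinite_def by auto
  show ?thesis
  proof
    have "subset.chain Q (As ` Field ?r)"
      using incr As(1) wo_rel.TOTALS[of ?r] wo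
      unfolding subset_chain_def relChain_def wo_rel_def by blast
    then show "(\<Union>i\<in>Field ?r. As i) \<in> Q" using Union_chain ne by blast
    show "|\<Union>i\<in>Field ?r. As i| \<le>o \<chi>" using UNION_Cinfinite_bound card_r \<chi>(1) As(2) by blast
    show "A0 \<subseteq> (\<Union>i\<in>Field ?r. As i)" using ne step_in unfolding closure_step_def by blast
    fix R assume R: "R \<in> subsets_upto \<mu> (\<Union>i\<in>Field ?r. As i)"
    then obtain i where "i \<in> Field ?r" "R \<subseteq> As i"
      using cardSuc_UNION_Cinfinite[OF \<mu> incr] unfolding subsets_upto_def by blast
    then show "F R \<subseteq> (\<Union>i\<in>Field ?r. As i)"
      using R step_in unfolding closure_step_def subsets_upto_def by blast
  qed
qed

section \<open>Structures\<close>

lemma tuples_mono: "A \<subseteq> B \<Longrightarrow> tuples A n \<subseteq> tuples B n"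
  unfolding tuples_def by blast

lemma tuples_subsetD: "xs \<in> tuples A n \<Longrightarrow> set xs \<subseteq> A"
  unfolding tuples_def by blast

lemma map_in_tuples: "h ` A \<subseteq> B \<Longrightarrow> xs \<in> tuples A n \<Longrightarrow> map h xs \<in> tuples B n"
  unfolding tuples_def by auto

lemma tuples_image: "tuples (h ` A) n = map h ` tuples A n"
proof -
  have "ys \<in> map h ` tuples A n" if "ys \<in> tuples (h ` A) n" for ys
  proof -
    have "ys \<in> lists (h ` A)" using tuples_subsetD[OF that] by auto
    then show ?thesis using that by (auto simp: lists_image tuples_def)
  qed
  then show ?thesis using map_in_tuples[OF subset_refl] by blast
qed

lemma tuples_Union_chain:
  assumes chain: "subset.chain \<A> \<C>" "\<C> \<noteq> {}" and xs: "xs \<in> tuples (\<Union>\<C>) n"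
  obtains A where "A \<in> \<C>" "xs \<in> tuples A n"
proof -
  obtain A where "A \<in> \<C>" "set xs \<subseteq> A"
    using finite_subset_Union_chain[OF finite_set tuples_subsetD[OF xs] chain(2,1)] .
  then show ?thesis using that xs unfolding tuples_def by blast
qed

lemma card_of_tuples:
  assumes X: "|X| \<le>o r" and r: "Cinfinite r"
  shows "|tuples X n| \<le>o r"
proof (induction n)
  case 0
  have "tuples X 0 = {[]}" unfolding tuples_def by auto
  then show ?case
    using r Card_order_singl_ordLeq[of r] infinite_imp_nonempty unfolding cinfinite_def by metis
next
  case (Suc n)
  have "tuples X (Suc n) \<subseteq> (\<lambda>(x, xs). x # xs) ` (X \<times> tuples X n)"
    unfolding tuples_def by (auto simp: length_Suc_conv image_iff)
  then have "|tuples X (Suc n)| \<le>o |X \<times> tuples X n|" by (rule surj_imp_ordLeq)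
  also have "|X \<times> tuples X n| \<le>o r"
    using card_of_Times_ordLeq_infinite_Field r X Suc unfolding cinfinite_def by blast
  finally show ?case .
qed

lemma card_of_lists:
  assumes X: "|X| \<le>o r" and r: "Cinfinite r"
  shows "|lists X| \<le>o r"
proof -
  have "|UNIV :: nat set| \<le>o r"
    using r infinite_iff_card_of_nat[of "Field r"] card_of_Field_ordIso ordLeq_ordIso_trans
    unfolding cinfinite_def by blast
  then have "|\<Union>n. tuples X n| \<le>o r"
    using UNION_Cinfinite_bound[of UNIV r "tuples X"] card_of_tuples[OF X r] r by blast
  moreover have "lists X = (\<Union>n. tuples X n)" unfolding tuples_def by auto
  ultimately show ?thesis by simp
qed

lemma is_struct_eqI:
  assumes "is_struct L M" "is_struct L N" "univ M = univ N"
    and "\<And>f xs. f \<in> funs L \<Longrightarrow> xs \<in> tuples (univ M) (fun_ar L f) \<Longrightarrow> fint M f xs = fint N f xs"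
    and "\<And>R xs. R \<in> rels L \<Longrightarrow> xs \<in> tuples (univ M) (rel_ar L R) \<Longrightarrow> rint M R xs = rint N R xs"
  shows "M = N"
proof -
  have "fint M f xs = fint N f xs" for f xs
    using assms unfolding is_struct_def by metis
  moreover have "rint M R xs = rint N R xs" for R xs
    using assms unfolding is_struct_def by metis
  ultimately show ?thesis using assms(3) by (simp add: fun_eq_iff)
qed

lemma Plus_eq_iff: "A <+> B = A' <+> B' \<longleftrightarrow> A = A' \<and> B = B'"
  by (auto simp: set_eq_iff Plus_def image_iff)

definition diagram ::
  "('f, 'r) language \<Rightarrow> ('f, 'r, 'a) struct \<Rightarrow> ('a + ('f \<times> 'a list \<times> 'a) + ('r \<times> 'a list)) set" where
  "diagram L M = univ M <+>
     {(f, xs, fint M f xs) |f xs. f \<in> funs L \<and> xs \<in> tuples (univ M) (fun_ar L f)} <+>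
     {(R, xs) |R xs. R \<in> rels L \<and> xs \<in> tuples (univ M) (rel_ar L R) \<and> rint M R xs}"

lemma inj_on_diagram:
  fixes L :: "('f, 'r) language"
  shows "inj_on (diagram L) {M. is_struct L M}"
proof (rule inj_onI)
  fix M N :: "('f, 'r, 'a) struct"
  assume MN: "M \<in> {M. is_struct L M}" "N \<in> {M. is_struct L M}" and "diagram L M = diagram L N"
  then have univ: "univ M = univ N"
    and fint: "{(f, xs, fint M f xs) |f xs. f \<in> funs L \<and> xs \<in> tuples (univ M) (fun_ar L f)} =
      {(f, xs, fint N f xs) |f xs. f \<in> funs L \<and> xs \<in> tuples (univ N) (fun_ar L f)}"
    and rint: "{(R, xs) |R xs. R \<in> rels L \<and> xs \<in> tuples (univ M) (rel_ar L R) \<and> rint M R xs} =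
      {(R, xs) |R xs. R \<in> rels L \<and> xs \<in> tuples (univ N) (rel_ar L R) \<and> rint N R xs}"
    unfolding diagram_def Plus_eq_iff by iprover+
  show "M = N"
  proof (rule is_struct_eqI[of L])
    fix f xs assume "f \<in> funs L" "xs \<in> tuples (univ M) (fun_ar L f)"
    then have "(f, xs, fint M f xs) \<in>
        {(f, xs, fint N f xs) |f xs. f \<in> funs L \<and> xs \<in> tuples (univ N) (fun_ar L f)}"
      unfolding fint[symmetric] by blast
    then show "fint M f xs = fint N f xs" by blast
  next
    fix R xs assume "R \<in> rels L" "xs \<in> tuples (univ M) (rel_ar L R)"
    then show "rint M R xs = rint N R xs"
      using eqset_imp_iff[OF rint, of "(R, xs)"] univ by simp
  qed (use MN univ in auto)
qed

lemma diagram_subset: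
  assumes M: "is_struct L M" "univ M \<subseteq> X"
  shows "diagram L M \<subseteq> X <+> (funs L \<times> lists X \<times> X) <+> (rels L \<times> lists X)"
proof -
  have "fint M f xs \<in> X" if "f \<in> funs L" "xs \<in> tuples (univ M) (fun_ar L f)" for f xs
    using that M unfolding is_struct_def by (meson subsetD)
  moreover have "xs \<in> lists X" if "xs \<in> tuples (univ M) n" for xs n
    using tuples_subsetD[OF that] M(2) by auto
  ultimately show ?thesis unfolding diagram_def using M(2) by blast
qed

lemma card_of_structs:
  assumes r: "Cinfinite r" and X: "|X| \<le>o r" and L: "|funs L| \<le>o r" "|rels L| \<le>o r"
  shows "|{M. is_struct L M \<and> univ M \<subseteq> X}| \<le>o ctwo ^c r"
proof -
  have "|{M. is_struct L M \<and> univ M \<subseteq> X}|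
      \<le>o |Pow (X <+> (funs L \<times> lists X \<times> X) <+> (rels L \<times> lists X))|"
  proof (rule card_of_ordLeqI)
    show "inj_on (diagram L) {M. is_struct L M \<and> univ M \<subseteq> X}"
      by (rule inj_on_subset[OF inj_on_diagram]) blast
  qed (use diagram_subset in blast)
  also have "|Pow (X <+> (funs L \<times> lists X \<times> X) <+> (rels L \<times> lists X))| \<le>o ctwo ^c r"
    by (intro card_of_Pow_ordLeq card_of_Plus_ordLeq_infinite_Field
        card_of_Times_ordLeq_infinite_Field card_of_lists X L r)
      (use r in \<open>auto simp: cinfinite_def\<close>)
  finally show ?thesis .
qed

definition restr :: "('f, 'r) language \<Rightarrow> ('f, 'r, 'a) struct \<Rightarrow> 'a set \<Rightarrow> ('f, 'r, 'a) struct" where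
  "restr L M A =
     \<lparr>univ = A,
      fint = (\<lambda>f xs. if f \<in> funs L \<and> xs \<in> tuples A (fun_ar L f) then fint M f xs else undefined),
      rint = (\<lambda>R xs. R \<in> rels L \<and> xs \<in> tuples A (rel_ar L R) \<and> rint M R xs)\<rparr>"

lemma univ_restr [simp]: "univ (restr L M A) = A"
  unfolding restr_def by simp

lemma fint_restr: "f \<in> funs L \<Longrightarrow> xs \<in> tuples A (fun_ar L f) \<Longrightarrow> fint (restr L M A) f xs = fint M f xs"
  and rint_restr: "R \<in> rels L \<Longrightarrow> xs \<in> tuples A (rel_ar L R) \<Longrightarrow> rint (restr L M A) R xs = rint M R xs"
  unfolding restr_def by simp_all

lemma substruct_restr_iff:
  assumes "is_struct L M"
  shows "substruct L (restr L M A) M \<longleftrightarrow> A \<noteq> {} \<and> A \<subseteq> univ M \<and>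
    (\<forall>f\<in>funs L. \<forall>xs\<in>tuples A (fun_ar L f). fint M f xs \<in> A)"
  using assms unfolding substruct_def is_struct_def restr_def by auto

lemma substruct_restr_mono:
  assumes "substruct L (restr L M A) M" "substruct L (restr L M B) M" "A \<subseteq> B"
  shows "substruct L (restr L M A) (restr L M B)"
  using assms tuples_mono[OF assms(3)] unfolding substruct_def restr_def by auto

lemma substruct_eq_restr:
  assumes "substruct L M N" shows "M = restr L N (univ M)"
proof -
  have "fint M = fint (restr L N (univ M))" "rint M = rint (restr L N (univ M))"
    using assms unfolding substruct_def is_struct_def restr_def by (auto simp: fun_eq_iff) metis+
  then show ?thesis by simp
qed

lemma is_iso_id: "is_struct L M \<Longrightarrow> is_iso L id M M"
  unfolding is_iso_def by simp

lemma is_iso_fint: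
  "is_iso L g M N \<Longrightarrow> f \<in> funs L \<Longrightarrow> xs \<in> tuples (univ M) (fun_ar L f) \<Longrightarrow>
    g (fint M f xs) = fint N f (map g xs)"
  and is_iso_rint:
  "is_iso L g M N \<Longrightarrow> R \<in> rels L \<Longrightarrow> xs \<in> tuples (univ M) (rel_ar L R) \<Longrightarrow>
    rint M R xs = rint N R (map g xs)"
  and is_iso_bij: "is_iso L g M N \<Longrightarrow> bij_betw g (univ M) (univ N)"
  and is_iso_struct: "is_iso L g M N \<Longrightarrow> is_struct L M" "is_iso L g M N \<Longrightarrow> is_struct L N"
  by (simp_all add: is_iso_def)

lemma is_iso_image: "is_iso L g M N \<Longrightarrow> g ` univ M = univ N"
  using is_iso_bij bij_betw_def by metis

lemma is_iso_comp:
  assumes g: "is_iso L g M N" and h: "is_iso L h N P" shows "is_iso L (h \<circ> g) M P"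
proof -
  have "map g xs \<in> tuples (univ N) n" if "xs \<in> tuples (univ M) n" for xs n
    using map_in_tuples[OF equalityD1[OF is_iso_image[OF g]] that] .
  then show ?thesis using g h bij_betw_trans[of g "univ M" "univ N" h "univ P"]
    unfolding is_iso_def by (auto simp flip: map_map)
qed

lemma is_iso_inv:
  assumes g: "is_iso L g M N"
  shows "is_iso L (inv_into (univ M) g) N M"
proof -
  let ?h = "inv_into (univ M) g"
  have hg: "?h (g x) = x" if "x \<in> univ M" for x
    using is_iso_bij[OF g] that by (simp add: bij_betw_inv_into_left)
  then have map_hg: "map ?h (map g xs) = xs" if "xs \<in> tuples (univ M) n" for xs n
    using tuples_subsetD[OF that] by (auto intro!: map_idI)
  have tuples_N: "tuples (univ N) n = map g ` tuples (univ M) n" for n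
    using tuples_image is_iso_image[OF g] by metis
  have "?h (fint N f ys) = fint M f (map ?h ys)"
    if f: "f \<in> funs L" and ys: "ys \<in> tuples (univ N) (fun_ar L f)" for f ys
  proof -
    obtain xs where xs: "xs \<in> tuples (univ M) (fun_ar L f)" "ys = map g xs"
      using ys unfolding tuples_N by blast
    have "fint M f xs \<in> univ M"
      using is_iso_struct(1)[OF g] f xs(1) unfolding is_struct_def by metis
    then show ?thesis using is_iso_fint[OF g f xs(1)] hg map_hg[OF xs(1)] xs(2) by metis
  qed
  moreover have "rint N R ys = rint M R (map ?h ys)"
    if R: "R \<in> rels L" and ys: "ys \<in> tuples (univ N) (rel_ar L R)" for R ys
  proof -
    obtain xs where xs: "xs \<in> tuples (univ M) (rel_ar L R)" "ys = map g xs"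
      using ys unfolding tuples_N by blast
    then show ?thesis using is_iso_rint[OF g R xs(1)] map_hg[OF xs(1)] by metis
  qed
  ultimately show ?thesis
    using is_iso_struct[OF g] bij_betw_inv_into[OF is_iso_bij[OF g]] unfolding is_iso_def by blast
qed

context
  fixes L :: "('f, 'r) language" and M N :: "('f, 'r, 'a) struct" and A :: "'a set"
    and h :: "'a \<Rightarrow> 'a"
  assumes A: "substruct L (restr L M A) M"
    and ext: "\<And>F. finite F \<Longrightarrow> F \<subseteq> A \<Longrightarrow> \<exists>g. is_iso L g M N \<and> (\<forall>x\<in>F. g x = h x)"
begin

lemma finitely_extendable_structs: "is_struct L M" "is_struct L N"
  using ext[of "{}"] is_iso_struct by blast+

lemma finitely_extendable_domain: "A \<noteq> {}" "A \<subseteq> univ M"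
  and finitely_extendable_closed:
    "f \<in> funs L \<Longrightarrow> xs \<in> tuples A (fun_ar L f) \<Longrightarrow> fint M f xs \<in> A"
  using A substruct_restr_iff[OF finitely_extendable_structs(1)] by blast+

lemma finitely_extendable_fint:
  assumes f: "f \<in> funs L" and xs: "xs \<in> tuples A (fun_ar L f)"
  shows "h (fint M f xs) = fint N f (map h xs)"
proof -
  have "insert (fint M f xs) (set xs) \<subseteq> A"
    using finitely_extendable_closed[OF f xs] tuples_subsetD[OF xs] by blast
  then obtain g where g: "is_iso L g M N" "\<forall>x\<in>insert (fint M f xs) (set xs). g x = h x"
    using ext[of "insert (fint M f xs) (set xs)"] by blast
  have "xs \<in> tuples (univ M) (fun_ar L f)"
    using tuples_mono[OF finitely_extendable_domain(2)] xs by blast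
  moreover have "map g xs = map h xs" using g(2) by simp
  ultimately show ?thesis using is_iso_fint[OF g(1) f] g(2) by (metis insertI1)
qed

lemma finitely_extendable_rint:
  assumes R: "R \<in> rels L" and xs: "xs \<in> tuples A (rel_ar L R)"
  shows "rint M R xs = rint N R (map h xs)"
proof -
  obtain g where g: "is_iso L g M N" "\<forall>x\<in>set xs. g x = h x"
    using ext[OF finite_set tuples_subsetD[OF xs]] by blast
  have "xs \<in> tuples (univ M) (rel_ar L R)"
    using tuples_mono[OF finitely_extendable_domain(2)] xs by blast
  moreover have "map g xs = map h xs" using g(2) by simp
  ultimately show ?thesis using is_iso_rint[OF g(1) R] by metis
qed

lemma finitely_extendable_inj_on: "inj_on h A"
proof (rule inj_onI)
  fix x y assume xy: "x \<in> A" "y \<in> A" "h x = h y"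
  obtain g where g: "is_iso L g M N" "g x = h x" "g y = h y" using ext[of "{x, y}"] xy(1,2) by auto
  have "inj_on g (univ M)" using is_iso_bij[OF g(1)] by (rule bij_betw_imp_inj_on)
  then show "x = y" using g(2,3) xy finitely_extendable_domain(2) by (metis inj_onD subsetD)
qed

lemma substruct_restr_image_if_finitely_extendable: "substruct L (restr L N (h ` A)) N"
proof -
  have "h x \<in> univ N" if "x \<in> A" for x
    using ext[of "{x}"] that finitely_extendable_domain(2) bij_betwE[OF is_iso_bij] by fastforce
  moreover have "fint N f ys \<in> h ` A"
    if f: "f \<in> funs L" and ys: "ys \<in> tuples (h ` A) (fun_ar L f)" for f ys
  proof -
    obtain xs where "xs \<in> tuples A (fun_ar L f)" "ys = map h xs"
      using ys unfolding tuples_image by blast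
    then show ?thesis
      using finitely_extendable_fint[OF f] finitely_extendable_closed[OF f] by (metis image_eqI)
  qed
  ultimately show ?thesis
    unfolding substruct_restr_iff[OF finitely_extendable_structs(2)]
    using finitely_extendable_domain(1) by blast
qed

lemma is_iso_restr_if_finitely_extendable: "is_iso L h (restr L M A) (restr L N (h ` A))"
  using A substruct_restr_image_if_finitely_extendable finitely_extendable_fint
    finitely_extendable_rint inj_on_imp_bij_betw[OF finitely_extendable_inj_on]
    map_in_tuples[OF subset_refl, of _ A _ h]
  unfolding is_iso_def substruct_def by (simp add: fint_restr rint_restr)

end

definition image_struct ::
  "('f, 'r) language \<Rightarrow> ('a \<Rightarrow> 'a) \<Rightarrow> ('f, 'r, 'a) struct \<Rightarrow> ('f, 'r, 'a) struct" where
  "image_struct L h M =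
     \<lparr>univ = h ` univ M,
      fint = (\<lambda>f ys. if f \<in> funs L \<and> ys \<in> tuples (h ` univ M) (fun_ar L f)
        then h (fint M f (map (inv_into (univ M) h) ys)) else undefined),
      rint = (\<lambda>R ys. R \<in> rels L \<and> ys \<in> tuples (h ` univ M) (rel_ar L R) \<and>
        rint M R (map (inv_into (univ M) h) ys))\<rparr>"

lemma univ_image_struct [simp]: "univ (image_struct L h M) = h ` univ M"
  unfolding image_struct_def by simp

lemma is_iso_image_struct:
  assumes M: "is_struct L M" and h: "inj_on h (univ M)"
  shows "is_iso L h M (image_struct L h M)"
proof -
  let ?inv = "inv_into (univ M) h"
  have inv_h: "map ?inv (map h xs) = xs" if "xs \<in> tuples (univ M) n" for xs n
    using tuples_subsetD[OF that] h by (auto intro!: map_idI)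
  have "fint M f (map ?inv ys) \<in> univ M"
    if f: "f \<in> funs L" and ys: "ys \<in> tuples (h ` univ M) (fun_ar L f)" for f ys
  proof -
    obtain xs where "xs \<in> tuples (univ M) (fun_ar L f)" "ys = map h xs"
      using ys unfolding tuples_image by blast
    then show ?thesis using M f inv_h unfolding is_struct_def by metis
  qed
  moreover have "univ M \<noteq> {}" using M unfolding is_struct_def by blast
  ultimately have "is_struct L (image_struct L h M)"
    unfolding is_struct_def image_struct_def by auto
  then show ?thesis
    using M inj_on_imp_bij_betw[OF h] map_in_tuples[OF subset_refl, of _ "univ M" _ h] inv_h
    unfolding is_iso_def by (simp add: image_struct_def del: map_map)
qed

lemma is_iso_if_image_struct_eq:
  assumes M: "is_struct L M" "inj_on h (univ M)" and N: "is_struct L N" "inj_on k (univ N)"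
    and eq: "image_struct L h M = image_struct L k N"
  shows "is_iso L (inv_into (univ N) k \<circ> h) M N"
  using is_iso_comp[OF is_iso_image_struct[OF M]] is_iso_inv[OF is_iso_image_struct[OF N]] eq
  by simp

section \<open>Submodels and automorphisms of a monster model\<close>

locale monster_model =
  fixes K :: "('f, 'r, 'a) aec" and kbar :: "'a rel" and C :: "('f, 'r, 'a) struct"
  assumes aec: "AEC K" and monster: "monster K kbar C"
begin

lemma mods_struct: "M \<in> mods K \<Longrightarrow> is_struct (lang K) M"
  using aec unfolding AEC_def by (elim conjE) blast

lemma leK_mods: "leK K M N \<Longrightarrow> M \<in> mods K"
  using aec unfolding AEC_def by (elim conjE) blast

lemma leK_substruct: "leK K M N \<Longrightarrow> substruct (lang K) M N"
  using aec unfolding AEC_def by (elim conjE) blast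

lemma leK_refl: "M \<in> mods K \<Longrightarrow> leK K M M"
  using aec unfolding AEC_def by (elim conjE) blast

lemma leK_trans: "leK K M N \<Longrightarrow> leK K N P \<Longrightarrow> leK K M P"
  using aec unfolding AEC_def by (elim conjE) blast

lemma leK_iso:
  "leK K M N \<Longrightarrow> is_iso (lang K) h N N' \<Longrightarrow> is_iso (lang K) h M M' \<Longrightarrow> leK K M' N'"
  using aec unfolding AEC_def by (elim conjE) blast

lemma leK_coherence: "leK K M P \<Longrightarrow> leK K N P \<Longrightarrow> substruct (lang K) M N \<Longrightarrow> leK K M N"
  using aec unfolding AEC_def by (elim conjE) blast

lemma chain_union_leK: "chain_union K \<C> U \<Longrightarrow> \<forall>M\<in>\<C>. leK K M N \<Longrightarrow> leK K U N"
  using aec unfolding AEC_def by (elim conjE) iprover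

lemma C_mods: "C \<in> mods K"
  using monster unfolding monster_def by blast

lemma C_struct: "is_struct (lang K) C"
  using mods_struct C_mods by blast

lemma leK_univ_subset: "leK K M N \<Longrightarrow> univ M \<subseteq> univ N"
  using leK_substruct unfolding substruct_def by blast

lemma strong_limit_kbar: "strong_limit kbar"
  using monster unfolding monster_def by blast

lemma Cinfinite_kbar: "Cinfinite kbar"
  using strong_limit_kbar unfolding strong_limit_def by blast

abbreviation sub :: "'a set \<Rightarrow> ('f, 'r, 'a) struct" where
  "sub A \<equiv> restr (lang K) C A"

definition submodel :: "'a set \<Rightarrow> bool" where
  "submodel A \<longleftrightarrow> leK K (sub A) C"

lemma sub_univ: "leK K M C \<Longrightarrow> sub (univ M) = M"
  using substruct_eq_restr leK_substruct by metis

lemma submodel_univ: "leK K M C \<Longrightarrow> submodel (univ M)"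
  unfolding submodel_def using sub_univ by metis

lemma submodel_univ_C: "submodel (univ C)"
  using submodel_univ leK_refl C_mods by blast

lemma submodel_substruct: "submodel A \<Longrightarrow> substruct (lang K) (sub A) C"
  unfolding submodel_def by (rule leK_substruct)

lemma submodel_subset_univ: "submodel A \<Longrightarrow> A \<subseteq> univ C"
  and submodel_nonempty: "submodel A \<Longrightarrow> A \<noteq> {}"
  and submodel_closed:
    "submodel A \<Longrightarrow> f \<in> funs (lang K) \<Longrightarrow> xs \<in> tuples A (fun_ar (lang K) f) \<Longrightarrow> fint C f xs \<in> A"
  using submodel_substruct substruct_restr_iff[OF C_struct] by blast+

lemma submodel_leK:
  assumes "submodel A" "submodel B" "A \<subseteq> B"
  shows "leK K (sub A) (sub B)"
proof (rule leK_coherence)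
  show "substruct (lang K) (sub A) (sub B)"
    using substruct_restr_mono submodel_substruct assms by blast
qed (use assms in \<open>auto simp: submodel_def\<close>)

definition submodels_upto :: "'k rel \<Rightarrow> 'a set \<Rightarrow> 'a set set" where
  "submodels_upto k A = {B \<in> subsets_upto k A. submodel B}"

lemma submodels_upto_iff: "B \<in> submodels_upto k A \<longleftrightarrow> submodel B \<and> B \<subseteq> A \<and> |B| \<le>o k"
  unfolding submodels_upto_def subsets_upto_def using submodel_nonempty by blast

lemma submodels_upto_subset: "submodels_upto k A \<subseteq> subsets_upto k A"
  unfolding submodels_upto_def by blast

lemma substruct_Union_chain:
  assumes chain: "subset.chain (Collect submodel) \<C>" "\<C> \<noteq> {}"
  shows "substruct (lang K) (sub (\<Union>\<C>)) C"
proof -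
  have submodel: "submodel A" if "A \<in> \<C>" for A
    using chain(1) that unfolding subset_chain_def by blast
  have "fint C f xs \<in> \<Union>\<C>"
    if f: "f \<in> funs (lang K)" and xs: "xs \<in> tuples (\<Union>\<C>) (fun_ar (lang K) f)" for f xs
    using tuples_Union_chain[OF chain xs] submodel_closed[OF submodel f] by blast
  moreover have "\<Union>\<C> \<noteq> {}" "\<Union>\<C> \<subseteq> univ C"
    using chain(2) submodel submodel_subset_univ submodel_nonempty by blast+
  ultimately show ?thesis unfolding substruct_restr_iff[OF C_struct] by blast
qed

lemma submodel_Union_chain:
  assumes chain: "subset.chain (Collect submodel) \<C>" "\<C> \<noteq> {}"
  shows "submodel (\<Union>\<C>)"
proof -
  obtain \<D> where \<D>: "\<D> \<subseteq> \<C>" "\<D> \<noteq> {}" "\<Union>\<D> = \<Union>\<C>"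
    and wo: "well_order_on \<D> {(A, B). A \<in> \<D> \<and> B \<in> \<D> \<and> A \<subseteq> B}"
    by (rule subset_chain_cofinal_wellorder[OF chain])
  have submodel: "submodel A" if "A \<in> \<D>" for A
    using chain(1) \<D>(1) that unfolding subset_chain_def by blast
  have leK_iff: "leK K (sub A) (sub B) \<longleftrightarrow> A \<subseteq> B" if "A \<in> \<D>" "B \<in> \<D>" for A B
    using submodel_leK submodel that leK_univ_subset[of "sub A" "sub B"] by auto
  let ?incl = "{(A, B). A \<in> \<D> \<and> B \<in> \<D> \<and> A \<subseteq> B}"
  let ?le = "{(M, N). M \<in> sub ` \<D> \<and> N \<in> sub ` \<D> \<and> leK K M N}"
  have le: "?le = dir_image ?incl sub" unfolding dir_image_def using leK_iff by fastforce
  have Field_incl: "Field ?incl = \<D>" by (auto simp: Field_def)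
  have "inj_on sub \<D>" by (rule inj_onI) (metis univ_restr)
  then have "Well_order ?le"
    unfolding le by (intro Well_order_dir_image) (use wo in \<open>simp_all add: Field_incl\<close>)
  moreover have "Field ?le = sub ` \<D>" unfolding le dir_image_Field Field_incl ..
  ultimately have wo_le: "well_order_on (sub ` \<D>) ?le" by simp
  have union: "substruct (lang K) (sub (\<Union>\<C>)) C" by (rule substruct_Union_chain[OF chain])
  have "chain_union K (sub ` \<D>) (sub (\<Union>\<C>))"
    unfolding chain_union_def
  proof (intro conjI wo_le)
    show "sub ` \<D> \<subseteq> mods K" using submodel leK_mods unfolding submodel_def by blast
    show "is_struct (lang K) (sub (\<Union>\<C>))" using union unfolding substruct_def by blast
    show "univ (sub (\<Union>\<C>)) = (\<Union>M\<in>sub ` \<D>. univ M)" using \<D>(3) by simp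
    show "\<forall>M\<in>sub ` \<D>. substruct (lang K) M (sub (\<Union>\<C>))"
      using substruct_restr_mono[OF submodel_substruct union] submodel \<D>(1) by blast
  qed (use \<D>(2) in blast)
  then show ?thesis
    unfolding submodel_def by (rule chain_union_leK) (use submodel in \<open>auto simp: submodel_def\<close>)
qed

lemma submodel_hull_exists:
  assumes LS: "LST_bound K LS" "LS \<le>o r" and r: "Cinfinite r"
    and W: "submodel W" and A: "A \<subseteq> W" "|A| \<le>o r"
  obtains B where "submodel B" "A \<subseteq> B" "B \<subseteq> W" "|B| \<le>o r"
proof -
  have "sub W \<in> mods K" using W leK_mods unfolding submodel_def by blast
  then obtain N where N: "leK K N (sub W)" "A \<subseteq> univ N" "|univ N| \<le>o |A| +c LS"
    using LS(1) A(1) unfolding LST_bound_def by (metis univ_restr)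
  have "|A| +c LS \<le>o r"
    using csum_cinfinite_bound[OF A(2) LS(2) card_of_Card_order _ r] LS(1)
    unfolding LST_bound_def by blast
  then have "|univ N| \<le>o r" using N(3) ordLeq_transitive by blast
  moreover have "submodel (univ N)"
    using N(1) W leK_trans submodel_univ unfolding submodel_def by blast
  moreover have "univ N \<subseteq> W" using leK_univ_subset[OF N(1)] by simp
  ultimately show ?thesis using that N(2) by blast
qed

abbreviation aut :: "('a \<Rightarrow> 'a) \<Rightarrow> bool" where
  "aut g \<equiv> is_iso (lang K) g C C"

lemma aut_id: "aut id" using is_iso_id C_struct by blast

lemma aut_in_univ: "aut g \<Longrightarrow> x \<in> univ C \<Longrightarrow> g x \<in> univ C"
  using is_iso_bij bij_betwE by metis

lemma aut_inverse:
  assumes "aut g"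
  obtains h where "aut h" "\<forall>x\<in>univ C. h (g x) = x \<and> g (h x) = x"
  using that[of "inv_into (univ C) g"] is_iso_inv[OF assms] is_iso_bij[OF assms]
  by (simp add: bij_betw_inv_into_left bij_betw_inv_into_right)

lemma is_iso_submodel_if_finitely_extendable:
  assumes A: "submodel A" and ext: "\<And>F. finite F \<Longrightarrow> F \<subseteq> A \<Longrightarrow> \<exists>g. aut g \<and> (\<forall>x\<in>F. g x = h x)"
  shows "is_iso (lang K) h (sub A) (sub (h ` A))"
  using is_iso_restr_if_finitely_extendable[OF submodel_substruct[OF A] ext] .

lemma is_iso_submodel_image: "aut g \<Longrightarrow> submodel A \<Longrightarrow> is_iso (lang K) g (sub A) (sub (g ` A))"
  by (rule is_iso_submodel_if_finitely_extendable) blast+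

lemma submodel_image: "aut g \<Longrightarrow> submodel A \<Longrightarrow> submodel (g ` A)"
  using leK_iso is_iso_submodel_image unfolding submodel_def by blast

lemma aut_extend:
  assumes "submodel A" "submodel B" "|A| <o kbar" "is_iso (lang K) h (sub A) (sub B)"
  obtains g where "aut g" "\<And>x. x \<in> A \<Longrightarrow> g x = h x"
  using assms monster unfolding monster_def submodel_def by (metis univ_restr)

definition aut_over :: "'a set \<Rightarrow> ('a \<Rightarrow> 'a) \<Rightarrow> bool" where
  "aut_over A g \<longleftrightarrow> aut g \<and> (\<forall>x\<in>A. g x = x)"

lemma aut_over_id: "aut_over A id"
  unfolding aut_over_def using aut_id by simp

lemma aut_over_comp: "aut_over A g \<Longrightarrow> aut_over A h \<Longrightarrow> aut_over A (h \<circ> g)"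
  unfolding aut_over_def using is_iso_comp by fastforce

lemma aut_over_mono: "aut_over B g \<Longrightarrow> A \<subseteq> B \<Longrightarrow> aut_over A g"
  unfolding aut_over_def by blast

lemma aut_over_inverse:
  assumes g: "aut_over A g" and A: "A \<subseteq> univ C"
  obtains h where "aut_over A h" "\<forall>x\<in>univ C. h (g x) = x"
proof -
  have "aut g" using g unfolding aut_over_def by blast
  then obtain h where "aut h" and hg: "\<forall>x\<in>univ C. h (g x) = x \<and> g (h x) = x"
    by (rule aut_inverse)
  moreover have "h x = x" if "x \<in> A" for x
    using hg g A that unfolding aut_over_def by (metis subsetD)
  ultimately have "aut_over A h" unfolding aut_over_def by blast
  then show ?thesis using that hg by blast
qed

definition aut_extending :: "('a \<times> 'a) set \<Rightarrow> ('a \<Rightarrow> 'a) \<Rightarrow> bool" where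
  "aut_extending H g \<longleftrightarrow> aut g \<and> (\<forall>x y. (x, y) \<in> H \<longrightarrow> g x = y)"

definition strong_map :: "('a \<times> 'a) set \<Rightarrow> bool" where
  "strong_map H \<longleftrightarrow> submodel (Domain H) \<and> (\<exists>g. aut_extending H g)"

lemma aut_extendingD: "aut_extending H g \<Longrightarrow> (x, y) \<in> H \<Longrightarrow> g x = y"
  unfolding aut_extending_def by blast

lemma aut_extending_aut: "aut_extending H g \<Longrightarrow> aut g"
  unfolding aut_extending_def by blast

lemma aut_extending_mono: "aut_extending H' g \<Longrightarrow> H \<subseteq> H' \<Longrightarrow> aut_extending H g"
  unfolding aut_extending_def by blast

lemma aut_extending_Id_on: "aut_extending (Id_on A) g \<longleftrightarrow> aut_over A g"
  unfolding aut_extending_def aut_over_def by auto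

lemma aut_extending_graph: "aut g \<Longrightarrow> aut_extending ((\<lambda>x. (x, g x)) ` A) g"
  unfolding aut_extending_def by auto

lemma strong_map_graph:
  assumes "submodel A" "aut g"
  shows "strong_map ((\<lambda>x. (x, g x)) ` A)"
proof -
  have "Domain ((\<lambda>x. (x, g x)) ` A) = A" by force
  then show ?thesis unfolding strong_map_def using assms aut_extending_graph by metis
qed

lemma strong_map_Id_on: "submodel A \<Longrightarrow> strong_map (Id_on A)"
  unfolding strong_map_def using aut_extending_Id_on aut_over_id by auto

lemma strong_map_chain_finite_extension:
  assumes chain: "subset.chain (Collect strong_map) \<H>" "\<H> \<noteq> {}"
    and F: "finite F" "F \<subseteq> \<Union>\<H>"
  obtains g where "aut_extending F g"
proof -
  obtain H where "H \<in> \<H>" and FH: "F \<subseteq> H" using finite_subset_Union_chain[OF F chain(2,1)] .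
  then obtain g where "aut_extending H g"
    using chain(1) unfolding subset_chain_def strong_map_def by blast
  then show ?thesis using that aut_extending_mono[OF _ FH] by blast
qed

lemma strong_map_chain_single_valued:
  assumes chain: "subset.chain (Collect strong_map) \<H>" "\<H> \<noteq> {}"
    and xy: "(x, y) \<in> \<Union>\<H>" and xz: "(x, z) \<in> \<Union>\<H>"
  shows "y = z"
proof -
  obtain g where "aut_extending {(x, y), (x, z)} g"
    by (rule strong_map_chain_finite_extension[OF chain, of "{(x, y), (x, z)}"]) (use xy xz in auto)
  then show ?thesis unfolding aut_extending_def by blast
qed

lemma strong_map_Union_chain:
  assumes chain: "subset.chain (Collect strong_map) \<H>" "\<H> \<noteq> {}"
    and small: "|Domain (\<Union>\<H>)| <o kbar"
  shows "strong_map (\<Union>\<H>)"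
proof -
  let ?P = "Domain (\<Union>\<H>)"
  have strong: "submodel (Domain H)" "\<exists>g. aut_extending H g" if "H \<in> \<H>" for H
    using chain(1) that unfolding subset_chain_def strong_map_def by blast+
  note unique = strong_map_chain_single_valued[OF chain]
  obtain h where h: "\<forall>x\<in>?P. (x, h x) \<in> \<Union>\<H>"
    using bchoice[of ?P "\<lambda>x y. (x, y) \<in> \<Union>\<H>"] by blast
  have Domain_chain: "subset.chain (Collect submodel) (Domain ` \<H>)"
    by (rule subset_chain_image[OF chain(1) Domain_mono]) (use strong(1) in simp_all)
  have "\<Union>(Domain ` \<H>) = ?P" by blast
  then have P: "submodel ?P" using submodel_Union_chain[OF Domain_chain] chain(2) by simp
  have "submodel (h ` Domain H)" if H: "H \<in> \<H>" for H
  proof -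
    obtain g where g: "aut_extending H g" using strong(2)[OF H] by blast
    have "g x = h x" if "x \<in> Domain H" for x
      using that h H unique aut_extendingD[OF g] by blast
    then have "h ` Domain H = g ` Domain H" by (intro image_cong) auto
    then show ?thesis using submodel_image[OF aut_extending_aut[OF g] strong(1)[OF H]] by simp
  qed
  then have "subset.chain (Collect submodel) ((`) h ` Domain ` \<H>)"
    by (intro subset_chain_image[OF Domain_chain image_mono]) auto
  then have "submodel (\<Union>((`) h ` Domain ` \<H>))" using submodel_Union_chain chain(2) by blast
  moreover have "\<Union>((`) h ` Domain ` \<H>) = h ` ?P" by blast
  ultimately have hP: "submodel (h ` ?P)" by simp
  have "is_iso (lang K) h (sub ?P) (sub (h ` ?P))"
  proof (rule is_iso_submodel_if_finitely_extendable[OF P])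
    fix F assume "finite F" "F \<subseteq> ?P"
    then have "finite ((\<lambda>x. (x, h x)) ` F)" "(\<lambda>x. (x, h x)) ` F \<subseteq> \<Union>\<H>" using h by auto
    then obtain g where "aut_extending ((\<lambda>x. (x, h x)) ` F) g"
      by (rule strong_map_chain_finite_extension[OF chain])
    then show "\<exists>g. aut g \<and> (\<forall>x\<in>F. g x = h x)" unfolding aut_extending_def by auto
  qed
  then obtain g where g: "aut g" "\<And>x. x \<in> ?P \<Longrightarrow> g x = h x" using aut_extend[OF P hP small] by blast
  then have "aut_extending (\<Union>\<H>) g"
    unfolding aut_extending_def using h unique by blast
  then show ?thesis unfolding strong_map_def using P by blast
qed

section \<open>Galois types\<close>

definition eqtp :: "'a set \<Rightarrow> 'i set \<Rightarrow> ('i \<Rightarrow> 'a) \<Rightarrow> ('i \<Rightarrow> 'a) \<Rightarrow> bool" where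
  "eqtp A I b b' \<longleftrightarrow> (\<exists>g. aut_over A g \<and> (\<forall>i\<in>I. g (b i) = b' i))"

lemma eqtp_refl: "eqtp A I b b"
  unfolding eqtp_def using aut_over_id by fastforce

lemma eqtp_trans: "eqtp A I b b' \<Longrightarrow> eqtp A I b' b'' \<Longrightarrow> eqtp A I b b''"
  unfolding eqtp_def using aut_over_comp by (metis comp_apply)

lemma eqtp_sym:
  assumes "eqtp A I b b'" "b \<in> I \<rightarrow> univ C" "A \<subseteq> univ C"
  shows "eqtp A I b' b"
proof -
  obtain g where g: "aut_over A g" "\<forall>i\<in>I. g (b i) = b' i" using assms(1) unfolding eqtp_def by blast
  obtain h where h: "aut_over A h" "\<forall>x\<in>univ C. h (g x) = x"
    using aut_over_inverse[OF g(1) assms(3)] .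
  have "h (b' i) = b i" if "i \<in> I" for i
    using g(2) h(2) assms(2) that by (metis PiE)
  then show ?thesis unfolding eqtp_def using h(1) by blast
qed

lemma eqtp_mono: "eqtp B I b b' \<Longrightarrow> A \<subseteq> B \<Longrightarrow> eqtp A I b b'"
  unfolding eqtp_def using aut_over_mono by blast

lemma eqtp_in_univ: "eqtp A I b b' \<Longrightarrow> b \<in> I \<rightarrow> univ C \<Longrightarrow> b' \<in> I \<rightarrow> univ C"
  unfolding eqtp_def aut_over_def using aut_in_univ by (metis Pi_iff)

lemma fst_gtp [simp]: "fst (gtp K C I b A) = A"
  unfolding gtp_def by simp

lemma gtp_subset_iff:
  assumes b: "b \<in> I \<rightarrow> univ C" and b': "b' \<in> I \<rightarrow> univ C" and A: "A \<subseteq> univ C" "A \<subseteq> B"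
  shows "snd (gtp K C I b B) \<subseteq> snd (gtp K C I b' A) \<longleftrightarrow> eqtp A I b b'"
proof
  assume "snd (gtp K C I b B) \<subseteq> snd (gtp K C I b' A)"
  moreover have "restrict (id \<circ> b) I \<in> snd (gtp K C I b B)"
    unfolding gtp_def using aut_id by (auto intro!: exI[of _ id])
  ultimately obtain g where g: "aut_over A g" "restrict b I = restrict (g \<circ> b') I"
    unfolding gtp_def aut_over_def by auto
  have "g (b' i) = b i" if "i \<in> I" for i
    using fun_cong[OF g(2), of i] that by simp
  then have "eqtp A I b' b" unfolding eqtp_def using g(1) by blast
  then show "eqtp A I b b'" using eqtp_sym b' A(1) by blast
next
  assume "eqtp A I b b'"
  then obtain h where h: "aut_over A h" "\<forall>i\<in>I. h (b' i) = b i"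
    using eqtp_sym b A(1) unfolding eqtp_def by blast
  have "restrict (g \<circ> b) I \<in> snd (gtp K C I b' A)" if g: "aut_over B g" for g
  proof -
    have "restrict (g \<circ> b) I = restrict ((g \<circ> h) \<circ> b') I" using h(2) by (auto simp: fun_eq_iff)
    moreover have "aut_over A (g \<circ> h)" using aut_over_comp h(1) aut_over_mono[OF g A(2)] by blast
    ultimately show ?thesis unfolding gtp_def aut_over_def by auto
  qed
  then show "snd (gtp K C I b B) \<subseteq> snd (gtp K C I b' A)" unfolding gtp_def aut_over_def by auto
qed

lemma extends_gtp_iff:
  assumes "b \<in> I \<rightarrow> univ C" "b' \<in> I \<rightarrow> univ C" "A \<subseteq> univ C"
  shows "extends (gtp K C I b B) (gtp K C I b' A) \<longleftrightarrow> A \<subseteq> B \<and> eqtp A I b b'"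
  unfolding extends_def using gtp_subset_iff[OF assms] by auto

lemma gtp_eq_iff:
  assumes b: "b \<in> I \<rightarrow> univ C" and b': "b' \<in> I \<rightarrow> univ C" and A: "A \<subseteq> univ C"
  shows "gtp K C I b A = gtp K C I b' A \<longleftrightarrow> eqtp A I b b'"
proof -
  have "gtp K C I b A = gtp K C I b' A \<longleftrightarrow>
      snd (gtp K C I b A) \<subseteq> snd (gtp K C I b' A) \<and> snd (gtp K C I b' A) \<subseteq> snd (gtp K C I b A)"
    by (auto simp: prod_eq_iff)
  then show ?thesis
    using gtp_subset_iff[OF b b' A subset_refl] gtp_subset_iff[OF b' b A subset_refl] eqtp_sym b A
    by blast
qed

abbreviation eqtp1 :: "'a set \<Rightarrow> 'a \<Rightarrow> 'a \<Rightarrow> bool" where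
  "eqtp1 A a b \<equiv> eqtp A (UNIV :: unit set) (\<lambda>_. a) (\<lambda>_. b)"

lemma eqtp1_iff: "eqtp1 A a b \<longleftrightarrow> (\<exists>g. aut_over A g \<and> g a = b)"
  unfolding eqtp_def by simp

lemma eqtp_singleton_iff: "eqtp A {x} b b' \<longleftrightarrow> eqtp1 A (b x) (b' x)"
  unfolding eqtp_def by simp

lemma eqtp1_sym: "eqtp1 A a b \<Longrightarrow> a \<in> univ C \<Longrightarrow> A \<subseteq> univ C \<Longrightarrow> eqtp1 A b a"
  using eqtp_sym by fast

lemma eqtp1_if_aut_extending:
  assumes H: "aut_extending H g" "aut_extending H h" "Domain H \<subseteq> univ C"
    and ab: "a \<in> univ C" "b \<in> univ C" "g a = h b"
  shows "eqtp1 (Domain H) a b"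
proof -
  obtain k where k: "aut k" "\<forall>x\<in>univ C. k (h x) = x \<and> h (k x) = x"
    using aut_inverse[OF aut_extending_aut[OF H(2)]] .
  have "k (g x) = x" if "(x, y) \<in> H" for x y
  proof -
    have "g x = h x" using aut_extendingD H(1,2) that by metis
    then show ?thesis using k(2) H(3) that by auto
  qed
  moreover have "k (g a) = b" using k(2) ab(2,3) by simp
  moreover have "aut (k \<circ> g)" using is_iso_comp aut_extending_aut[OF H(1)] k(1) by blast
  ultimately show ?thesis
    unfolding eqtp1_iff aut_over_def by (intro exI[of _ "k \<circ> g"]) auto
qed

lemma fst_tp1 [simp]: "fst (tp1 K C a A) = A"
  unfolding tp1_def by simp

lemma tp1_eq_iff:
  assumes "a \<in> univ C" "b \<in> univ C" "A \<subseteq> univ C"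
  shows "tp1 K C a A = tp1 K C b A \<longleftrightarrow> eqtp1 A a b"
  unfolding tp1_def using gtp_eq_iff[of "\<lambda>_. a" UNIV "\<lambda>_. b" A] assms by simp

lemma realizes_tp1_iff:
  assumes "a \<in> univ C" "b \<in> univ C" "A \<subseteq> univ C"
  shows "realizes K C a (tp1 K C b A) \<longleftrightarrow> eqtp1 A b a"
  unfolding realizes_def using tp1_eq_iff assms by auto

lemma realizes_eqtp:
  assumes a: "realizes K C a p" "a \<in> univ C" and eqtp: "eqtp1 A a b" and A: "fst p \<subseteq> A" "A \<subseteq> univ C"
  shows "realizes K C b p"
proof -
  have "b \<in> univ C" using eqtp_in_univ[OF eqtp] a(2) by blast
  moreover have "eqtp1 (fst p) a b" by (rule eqtp_mono[OF eqtp A(1)])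
  ultimately have "tp1 K C a (fst p) = tp1 K C b (fst p)" using tp1_eq_iff a(2) A by blast
  then show ?thesis using a(1) unfolding realizes_def by simp
qed

definition types_over :: "'a set \<Rightarrow> (unit, 'a) gtype set" where
  "types_over A = (\<lambda>a. tp1 K C a A) ` univ C"

text \<open>The number of types is bounded by coding a type over \<open>A\<close> by an isomorphic copy, inside
  \<open>Field \<mu>\<close>, of a model that contains \<open>A\<close> and a realization.\<close>

lemma eqtp1_if_image_struct_eq:
  assumes N: "submodel N" "inj_on e N" "insert a A \<subseteq> N" "|N| <o kbar"
    and N': "submodel N'" "inj_on e' N'" "insert a' A \<subseteq> N'"
    and eq: "image_struct (lang K) e (sub N) = image_struct (lang K) e' (sub N')"
    and A: "\<And>x. x \<in> A \<Longrightarrow> e x = e' x" and a: "e a = e' a'"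
  shows "eqtp1 A a a'"
proof -
  let ?h = "inv_into N' e' \<circ> e"
  have "is_iso (lang K) ?h (sub N) (sub N')"
    using is_iso_if_image_struct_eq[OF _ _ _ _ eq] N N' submodel_substruct unfolding substruct_def
    by simp
  then obtain g where g: "aut g" "\<And>x. x \<in> N \<Longrightarrow> g x = ?h x"
    using aut_extend N(1,4) N'(1) by blast
  have h: "?h x = y" if "y \<in> N'" "e x = e' y" for x y
    using inv_into_f_f[OF N'(2) that(1)] that(2) by simp
  have "g x = x" if "x \<in> A" for x using g(2) h[of x x] A that N(3) N'(3) by (simp add: subset_iff)
  moreover have "g a = a'" using g(2) h[of a' a] a N(3) N'(3) by simp
  ultimately show ?thesis unfolding eqtp1_iff aut_over_def using g(1) by blast
qed

lemma coded_submodel_exists: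
  fixes \<mu> :: "'a rel"
  assumes LS: "LST_bound K LS" "LS \<le>o \<mu>" and \<mu>: "Cinfinite \<mu>"
    and A: "A \<subseteq> univ C" "|A| \<le>o \<mu>" and a: "a \<in> univ C"
  shows "\<exists>N e. submodel N \<and> insert a A \<subseteq> N \<and> |N| \<le>o \<mu> \<and> inj_on e N \<and> e ` N \<subseteq> Field \<mu>"
proof -
  have "|{a}| \<le>o \<mu>" using Card_order_singl_ordLeq[of \<mu>] \<mu> unfolding cinfinite_def by fastforce
  then have "|insert a A| \<le>o \<mu>" using Un_Cinfinite_bound[of "{a}" \<mu> A] A(2) \<mu> by simp
  then obtain N where N: "submodel N" "insert a A \<subseteq> N" "|N| \<le>o \<mu>"
    using submodel_hull_exists[OF LS \<mu> submodel_univ_C] a A(1) by (metis insert_subset)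
  then have "|N| \<le>o |Field \<mu>|"
    using card_of_Field_ordIso[of \<mu>] \<mu> ordIso_symmetric ordLeq_ordIso_trans by blast
  then show ?thesis using N card_of_ordLeq[of N "Field \<mu>"] by blast
qed

lemma card_of_submodel_codes:
  fixes \<mu> :: "'a rel"
  assumes LS: "LST_bound K LS" "LS \<le>o \<mu>" and \<mu>: "Cinfinite \<mu>" and A: "|A| \<le>o \<mu>"
  shows "|{M. is_struct (lang K) M \<and> univ M \<subseteq> Field \<mu>} \<times> Pow (A \<times> Field \<mu>) \<times> Field \<mu>| \<le>o ctwo ^c \<mu>"
proof -
  have "|funs (lang K)| +c |rels (lang K)| \<le>o \<mu>"
    using LS ordLeq_transitive unfolding LST_bound_def by blast
  then have lang: "|funs (lang K)| \<le>o \<mu>" "|rels (lang K)| \<le>o \<mu>"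
    using ordLeq_csum1 ordLeq_csum2 card_of_Card_order ordLeq_transitive by blast+
  have Field: "|Field \<mu>| \<le>o \<mu>" using card_of_Field_ordIso \<mu> ordIso_iff_ordLeq by blast
  then have "|Field \<mu>| \<le>o ctwo ^c \<mu>"
    using ordLess_ctwo_cexp \<mu> ordLess_imp_ordLeq ordLeq_transitive by blast
  moreover have "|Pow (A \<times> Field \<mu>)| \<le>o ctwo ^c \<mu>"
    by (intro card_of_Pow_ordLeq card_of_Times_ordLeq_infinite_Field A Field)
      (use \<mu> in \<open>auto simp: cinfinite_def\<close>)
  moreover have "Cinfinite (ctwo ^c \<mu>)"
    using Cinfinite_cexp \<mu> ordLeq_refl Card_order_ctwo by blast
  ultimately show ?thesis
    by (intro card_of_Times_ordLeq_infinite_Field card_of_structs[OF \<mu> Field lang])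
      (auto simp: cinfinite_def)
qed

lemma card_of_types_over:
  fixes \<mu> :: "'a rel"
  assumes LS: "LST_bound K LS" "LS \<le>o \<mu>" and \<mu>: "Cinfinite \<mu>" "\<mu> <o kbar"
    and A: "A \<subseteq> univ C" "|A| \<le>o \<mu>"
  shows "|types_over A| \<le>o ctwo ^c \<mu>"
proof -
  obtain N e where N: "\<And>a. a \<in> univ C \<Longrightarrow> submodel (N a)" "\<And>a. a \<in> univ C \<Longrightarrow> insert a A \<subseteq> N a"
      "\<And>a. a \<in> univ C \<Longrightarrow> |N a| \<le>o \<mu>"
    and e: "\<And>a. a \<in> univ C \<Longrightarrow> inj_on (e a) (N a)" "\<And>a. a \<in> univ C \<Longrightarrow> e a ` N a \<subseteq> Field \<mu>"
    using coded_submodel_exists[OF LS \<mu>(1) A] by metis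
  define code
    where "code a = (image_struct (lang K) (e a) (sub (N a)), (\<lambda>x. (x, e a x)) ` A, e a a)" for a
  have "tp1 K C a A = tp1 K C b A"
    if ab: "a \<in> univ C" "b \<in> univ C" and eq: "code a = code b" for a b
  proof -
    have "e a x = e b x" if "x \<in> A" for x
      using eq that unfolding code_def by (auto simp: set_eq_iff image_iff)
    moreover have "|N a| <o kbar" using N(3)[OF ab(1)] \<mu>(2) ordLeq_ordLess_trans by blast
    ultimately have "eqtp1 A a b"
      using eqtp1_if_image_struct_eq[of "N a" "e a" a A "N b" "e b" b] N(1,2) e(1) ab eq
      unfolding code_def by simp
    then show ?thesis using tp1_eq_iff ab A(1) by blast
  qed
  then have "|types_over A| \<le>o |code ` univ C|"
    unfolding types_over_def by (rule card_of_image_if_determined)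
  also have "|code ` univ C|
      \<le>o |{M. is_struct (lang K) M \<and> univ M \<subseteq> Field \<mu>} \<times> Pow (A \<times> Field \<mu>) \<times> Field \<mu>|"
  proof (rule card_of_mono1, rule image_subsetI)
    fix a assume a: "a \<in> univ C"
    have "is_struct (lang K) (image_struct (lang K) (e a) (sub (N a)))"
      using is_iso_struct(2)[OF is_iso_image_struct] N(1)[OF a] e(1)[OF a] submodel_substruct
      unfolding substruct_def by fastforce
    then show "code a \<in> {M. is_struct (lang K) M \<and> univ M \<subseteq> Field \<mu>} \<times> Pow (A \<times> Field \<mu>) \<times> Field \<mu>"
      unfolding code_def using e(2)[OF a] N(2)[OF a] by auto
  qed
  also have "|{M. is_struct (lang K) M \<and> univ M \<subseteq> Field \<mu>} \<times> Pow (A \<times> Field \<mu>) \<times> Field \<mu>|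
      \<le>o ctwo ^c \<mu>"
    by (rule card_of_submodel_codes[OF LS \<mu>(1) A(2)])
  finally show ?thesis .
qed

end

section \<open>Simple independence relations\<close>

locale simple_independence = monster_model K kbar C
  for K :: "('f, 'r, 'a) aec" and kbar :: "'a rel" and C :: "('f, 'r, 'a) struct" +
  fixes ind :: "('f, 'r, 'a) indrel"
  assumes simple: "simple_independence_relation K kbar C ind"
    and fin_witness: "finite_witness_singletons K kbar C ind"
begin

abbreviation small :: "'a set \<Rightarrow> bool" where
  "small A \<equiv> small_set kbar C A"

abbreviation indep :: "'a set \<Rightarrow> 'a set \<Rightarrow> 'a set \<Rightarrow> bool" where
  "indep A R B \<equiv> ind A (sub R) B"

lemma small_model_sub: "submodel R \<Longrightarrow> small R \<Longrightarrow> small_model K kbar C (sub R)"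
  unfolding small_model_def small_set_def submodel_def by simp

lemma small_submodel: "submodel A \<Longrightarrow> |A| <o kbar \<Longrightarrow> small A"
  unfolding small_set_def using submodel_subset_univ by blast

lemma small_subset_univ: "small A \<Longrightarrow> A \<subseteq> univ C"
  unfolding small_set_def by blast

lemma small_subset: "small A \<Longrightarrow> B \<subseteq> A \<Longrightarrow> small B"
  unfolding small_set_def using card_of_mono1 ordLeq_ordLess_trans by blast

lemma small_Un: "small A \<Longrightarrow> small B \<Longrightarrow> small (A \<union> B)"
  unfolding small_set_def using Un_Cinfinite_bound_strict Cinfinite_kbar by blast

lemma card_of_finite_less_kbar: "finite I \<Longrightarrow> |I| <o kbar"
  using finite_iff_ordLess_natLeq[of I] natLeq_ordLeq_cinfinite[OF Cinfinite_kbar]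
    ordLess_ordLeq_trans
  by blast

lemma small_singleton: "a \<in> univ C \<Longrightarrow> small {a}"
  unfolding small_set_def using card_of_finite_less_kbar[of "{a}"] by blast

lemma small_image: "|I| <o kbar \<Longrightarrow> b \<in> I \<rightarrow> univ C \<Longrightarrow> small (b ` I)"
  unfolding small_set_def using card_of_image[of b I] ordLeq_ordLess_trans by blast

lemma small_length_card_of: "|I| <o kbar \<Longrightarrow> small_length kbar |I|"
  unfolding small_length_def by (simp add: card_of_well_order_on Field_card_of)

lemma
  shows invariance: "ind_invariance K kbar C ind" and monotonicity: "ind_monotonicity K kbar C ind"
    and normality: "ind_normality K kbar C ind" and base_mono: "ind_base_monotonicity K kbar C ind"
    and existence: "ind_existence K kbar C ind" and transitivity: "ind_transitivity K kbar C ind"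
    and type_amalgamation: "type_amalgamation K kbar C ind"
  using simple unfolding simple_independence_relation_def independence_relation_def by blast+

lemma indep_image:
  assumes g: "aut_over R g" and R: "submodel R" "small R"
    and AB: "small A" "small B" "indep A R B"
  shows "indep (g ` A) R (g ` B)"
proof -
  have "aut g" "g ` R = R" using g unfolding aut_over_def by auto
  then have "is_iso (lang K) g (sub R) (sub R)" using is_iso_submodel_image[of g R] R(1) by simp
  then show ?thesis
    using invariance[unfolded ind_invariance_def, rule_format, of g "sub R" "sub R" A B]
      small_model_sub[OF R] AB \<open>aut g\<close> by blast
qed

lemma indep_mono:
  assumes "submodel R" "small R" "small A" "small B" "indep A R B" "A' \<subseteq> A" "B' \<subseteq> B"
  shows "indep A' R B'"
  using monotonicity[unfolded ind_monotonicity_def, rule_format, of "sub R" A B A' B']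
    small_model_sub assms by blast

lemma indep_normal:
  assumes "submodel R" "small R" "small A" "small B"
  shows "indep A R B \<longleftrightarrow> indep (A \<union> R) R (B \<union> R)"
  using normality[unfolded ind_normality_def, rule_format, of "sub R" A B]
    small_model_sub assms by simp

lemma indep_base_mono:
  assumes "submodel M" "submodel N" "small A" "small B" "M \<subseteq> N" "N \<subseteq> B" "indep A M B"
  shows "indep A N B"
proof -
  have "small N" "small M" using assms small_subset by blast+
  then show ?thesis
    using base_mono[unfolded ind_base_monotonicity_def, rule_format, of "sub M" "sub N" A B]
      small_model_sub submodel_leK assms by simp
qed

lemma indep_trans:
  assumes "submodel M" "submodel N" "small N" "small A" "small B" "M \<subseteq> N" "indep A M N"
    "indep A N B"
  shows "indep A M B"
proof -
  have "small M" using assms small_subset by blast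
  then show ?thesis
    using transitivity[unfolded ind_transitivity_def, rule_format, of "sub M" "sub N" A B]
      small_model_sub submodel_leK assms by simp
qed

lemma indep_eqtp:
  assumes R: "submodel R" "R \<subseteq> B" "small B" and I: "|I| <o kbar" "b \<in> I \<rightarrow> univ C"
    and indep: "indep (b ` I) R B" and eqtp: "eqtp B I b b'"
  shows "indep (b' ` I) R B"
proof -
  obtain g where g: "aut_over B g" "\<forall>i\<in>I. g (b i) = b' i" using eqtp unfolding eqtp_def by blast
  have "indep (g ` b ` I) R (g ` B)"
    using indep_image aut_over_mono[OF g(1) R(2)] R small_subset small_image[OF I] indep by blast
  moreover have "g ` B = B" "g ` b ` I = b' ` I" using g unfolding aut_over_def by force+
  ultimately show ?thesis by simp
qed

lemma indep_eqtp1: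
  assumes "submodel R" "R \<subseteq> B" "small B" "a \<in> univ C" "indep {a} R B" "eqtp1 B a a'"
  shows "indep {a'} R B"
  using indep_eqtp[OF assms(1-3), of "UNIV :: unit set" "\<lambda>_. a" "\<lambda>_. a'"] assms(4-6)
    card_of_finite_less_kbar[of "UNIV :: unit set"]
  by (simp add: image_constant_conv)

lemma indep_finite_character:
  assumes R: "submodel R" "R \<subseteq> P" and P: "submodel P" "small P" and a: "a \<in> univ C"
    and fin: "\<And>A. finite A \<Longrightarrow> A \<subseteq> P \<Longrightarrow> indep {a} R A"
  shows "indep {a} R P"
  using fin_witness[unfolded finite_witness_singletons_def, rule_format, of a "sub R" "sub P"]
    small_model_sub[OF R(1) small_subset[OF P(2) R(2)]] small_model_sub[OF P]
    submodel_leK[OF R(1) P(1) R(2)] a fin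
  by simp

lemma gS_card_of: "gS K C |I| A = {gtp K C I b A |b. b \<in> I \<rightarrow> univ C}"
  unfolding gS_def by (simp add: Field_card_of)

lemma does_not_fork_iff:
  fixes I :: "'a set"
  assumes R: "submodel R" "R \<subseteq> B" "small B" and I: "|I| <o kbar" "b \<in> I \<rightarrow> univ C"
  shows "does_not_fork K C ind |I| (gtp K C I b B) (sub R) \<longleftrightarrow> indep (b ` I) R B"
proof
  assume "does_not_fork K C ind |I| (gtp K C I b B) (sub R)"
  then obtain b' where b': "b' \<in> I \<rightarrow> univ C" "gtp K C I b B = gtp K C I b' B" "indep (b' ` I) R B"
    unfolding does_not_fork_def by (auto simp: Field_card_of)
  then have "eqtp B I b' b" using gtp_eq_iff[of b' I b B] I(2) small_subset_univ[OF R(3)] by auto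
  then show "indep (b ` I) R B" using indep_eqtp[OF R I(1) b'(1,3)] by blast
next
  assume "indep (b ` I) R B"
  then show "does_not_fork K C ind |I| (gtp K C I b B) (sub R)"
    unfolding does_not_fork_def using I(2) by (auto simp: Field_card_of)
qed

lemma nonforking_extension:
  fixes I :: "'a set"
  assumes I: "|I| <o kbar" "b \<in> I \<rightarrow> univ C" and M: "submodel M" "M \<subseteq> N"
    and N: "submodel N" "small N"
  obtains b' where "b' \<in> I \<rightarrow> univ C" "eqtp M I b' b" "indep (b' ` I) M N"
proof -
  have sM: "small M" by (rule small_subset[OF N(2) M(2)])
  have "gtp K C I b M \<in> gS K C |I| (univ (sub M))" using gS_card_of I(2) by auto
  then obtain q where q: "q \<in> gS K C |I| (univ (sub N))" "extends q (gtp K C I b M)"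
      "does_not_fork K C ind |I| q (sub M)"
    using existence[unfolded ind_existence_def, rule_format, of _ "|I|" "sub M" "sub N"]
      small_length_card_of[OF I(1)] small_model_sub[OF M(1) sM] small_model_sub[OF N] submodel_leK
        M N(1)
    by blast
  then obtain b' where b': "b' \<in> I \<rightarrow> univ C" "q = gtp K C I b' N" unfolding gS_card_of by auto
  have "eqtp M I b' b" using q(2) extends_gtp_iff b' I(2) submodel_subset_univ[OF M(1)] by blast
  moreover have "indep (b' ` I) M N" using q(3) does_not_fork_iff M N(2) I(1) b' by blast
  ultimately show ?thesis using that b'(1) by blast
qed

lemma nonforking_extension1:
  assumes a: "a \<in> univ C" and M: "submodel M" "M \<subseteq> N" and N: "submodel N" "small N"
  obtains a' where "a' \<in> univ C" "eqtp1 M a' a" "indep {a'} M N"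
proof -
  fix x :: 'a
  obtain b' where "b' \<in> {x} \<rightarrow> univ C" "eqtp M {x} b' (\<lambda>_. a)" "indep (b' ` {x}) M N"
    using nonforking_extension[of "{x}" "\<lambda>_. a", OF card_of_finite_less_kbar _ M N] a by auto
  then show ?thesis using that[of "b' x"] by (simp add: eqtp_singleton_iff)
qed

lemma nonforking_amalgamation:
  fixes I :: "'a set"
  assumes I: "|I| <o kbar" and R: "submodel R" "R \<subseteq> A" "R \<subseteq> B"
    and N: "submodel N" "small N" "A \<union> B \<subseteq> N"
    and AB: "indep A R B" and a: "a \<in> I \<rightarrow> univ C" "indep (a ` I) R A"
    and b: "b \<in> I \<rightarrow> univ C" "indep (b ` I) R B" and ab: "eqtp R I a b"
  obtains c where "c \<in> I \<rightarrow> univ C" "eqtp A I c a" "eqtp B I c b" "indep (c ` I) R N"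
proof -
  have small: "small A" "small B" "small R" using R N small_subset[of N] by blast+
  have in_gS: "gtp K C I b R \<in> gS K C |I| (univ (sub R))" "gtp K C I a A \<in> gS K C |I| A"
    "gtp K C I b B \<in> gS K C |I| B"
    unfolding gS_card_of using a b by auto
  have ext: "extends (gtp K C I a A) (gtp K C I b R)" "extends (gtp K C I b B) (gtp K C I b R)"
    using extends_gtp_iff[OF a(1) b(1) small_subset_univ[OF small(3)]] R(2) ab
      extends_gtp_iff[OF b(1) b(1) small_subset_univ[OF small(3)]] R(3) eqtp_refl by blast+
  have dnf: "does_not_fork K C ind |I| (gtp K C I a A) (sub R)"
    "does_not_fork K C ind |I| (gtp K C I b B) (sub R)"
    using does_not_fork_iff[OF R(1,2) small(1) I a(1)] does_not_fork_iff[OF R(1,3) small(2) I b(1)]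
      a(2) b(2)
    by blast+
  obtain q where q: "q \<in> gS K C |I| (univ (sub N))" "extends q (gtp K C I a A)"
      "extends q (gtp K C I b B)" "does_not_fork K C ind |I| q (sub R)"
    using type_amalgamation[unfolded type_amalgamation_def, rule_format, OF in_gS, of "sub N"]
      small_length_card_of[OF I] small_model_sub[OF R(1) small(3)] small_model_sub[OF N(1,2)]
      small(1,2) R(2,3) AB N(3) ext dnf
    by auto
  then obtain c where c: "c \<in> I \<rightarrow> univ C" "q = gtp K C I c N" unfolding gS_card_of by auto
  have "eqtp A I c a" "eqtp B I c b"
    using q(2,3) extends_gtp_iff[OF c(1) a(1)] extends_gtp_iff[OF c(1) b(1)] c(2)
      small_subset_univ small(1,2)
    by blast+
  moreover have "R \<subseteq> N" using R(2) N(3) by blast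
  then have "indep (c ` I) R N" using does_not_fork_iff[OF R(1) _ N(2) I c(1)] q(4) c(2) by blast
  ultimately show ?thesis using that c(1) by blast
qed

lemma nonforking_amalgamation1:
  assumes R: "submodel R" "R \<subseteq> A" "R \<subseteq> B" and N: "submodel N" "small N" "A \<union> B \<subseteq> N"
    and AB: "indep A R B" and a: "a \<in> univ C" "indep {a} R A" and b: "b \<in> univ C" "indep {b} R B"
    and ab: "eqtp1 R a b"
  obtains c where "c \<in> univ C" "eqtp1 A c a" "eqtp1 B c b" "indep {c} R N"
proof -
  fix x :: 'a
  obtain c where "c \<in> {x} \<rightarrow> univ C" "eqtp A {x} c (\<lambda>_. a)" "eqtp B {x} c (\<lambda>_. b)"
    "indep (c ` {x}) R N"
    using nonforking_amalgamation[of "{x}" R A B N "\<lambda>_. a" "\<lambda>_. b",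
        OF card_of_finite_less_kbar R N AB] a b ab
    by (auto simp: eqtp_singleton_iff)
  then show ?thesis using that[of "c x"] by (simp add: eqtp_singleton_iff)
qed

lemma indep_self:
  assumes "a \<in> univ C" "submodel R" "small R"
  shows "indep {a} R R"
proof -
  obtain a' where "a' \<in> univ C" "eqtp1 R a' a" "indep {a'} R R"
    using nonforking_extension1[OF assms(1,2) subset_refl assms(2,3)] .
  then show ?thesis using indep_eqtp1 assms by blast
qed

lemma local_character:
  assumes lc: "local_character_pair K kbar C ind kap ell"
    and A: "small A" and N: "submodel N" "small N"
  obtains M where "M \<subseteq> N" "submodel M" "|M| \<le>o kap +c cexp_less |A| ell" "indep A M N"
proof -
  have A': "|A| <o kbar" "id \<in> A \<rightarrow> univ C" using A unfolding small_set_def by auto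
  have "gtp K C A id N \<in> gS K C |A| (univ (sub N))" using gS_card_of A'(2) by auto
  then obtain M where M: "leK K M (sub N)" "|univ M| \<le>o kap +c cexp_less |Field |A| | ell"
      "does_not_fork K C ind |A| (gtp K C A id N) M"
    using lc[unfolded local_character_pair_def] small_length_card_of[OF A'(1)] small_model_sub[OF N]
    by blast
  have MC: "leK K M C" using M(1) N(1) leK_trans unfolding submodel_def by blast
  have MN: "univ M \<subseteq> N" using leK_univ_subset[OF M(1)] by simp
  have "indep (id ` A) (univ M) N"
    using does_not_fork_iff[OF submodel_univ[OF MC] MN N(2) A'] M(3) sub_univ[OF MC] by simp
  then show ?thesis using that[OF MN submodel_univ[OF MC]] M(2) by (simp add: Field_card_of)
qed

lemma local_character_singleton:
  assumes lc: "local_character_pair K kbar C ind kap ell"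
    and a: "a \<in> univ C" and N: "submodel N" "small N"
  obtains M where "M \<subseteq> N" "submodel M" "|M| \<le>o kap +c cone" "indep {a} M N"
  using local_character[OF lc small_singleton[OF a] N] csum_mono2[OF cexp_less_singleton]
    ordLeq_transitive
  by metis

lemma local_character_bounded:
  fixes \<mu> :: "'a rel"
  assumes lc: "local_character_pair K kbar C ind kap ell"
    and \<mu>: "Cinfinite \<mu>" "kap \<le>o \<mu>" "cexp_less \<mu> ell =o \<mu>"
    and A: "small A" "|A| \<le>o \<mu>" and N: "submodel N" "small N"
  obtains M where "M \<subseteq> N" "submodel M" "|M| \<le>o \<mu>" "indep A M N"
proof -
  have "cexp_less |A| ell \<le>o \<mu>" using cexp_less_mono1[OF A(2)] \<mu>(3) ordLeq_ordIso_trans by blast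
  moreover have "Card_order kap" using lc unfolding local_character_pair_def by blast
  ultimately have "kap +c cexp_less |A| ell \<le>o \<mu>"
    using csum_cinfinite_bound \<mu>(1,2) Card_order_cexp_less by blast
  then show ?thesis using local_character[OF lc A(1) N] that ordLeq_transitive by metis
qed

end

section \<open>Absorbing sets of types\<close>

text \<open>The first component has to grow strictly: the length of a chain is then bounded by the size
  of the union of the first components.\<close>

definition pair_le :: "'b set \<times> 'c set \<Rightarrow> 'b set \<times> 'c set \<Rightarrow> bool" where
  "pair_le x y \<longleftrightarrow> x = y \<or> fst x \<subset> fst y \<and> snd x \<subseteq> snd y"

lemma partial_order_pair_le: "partial_order_on A (relation_of pair_le A)"
  by (rule partial_order_on_relation_ofI) (auto simp: pair_le_def)

lemma Chains_pair_leD: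
  assumes "\<X> \<in> Chains (relation_of pair_le A)"
  shows "\<X> \<subseteq> A" and "\<And>x y. x \<in> \<X> \<Longrightarrow> y \<in> \<X> \<Longrightarrow> pair_le x y \<or> pair_le y x"
  using assms unfolding Chains_def relation_of_def by auto

lemma Chains_pair_le_snd:
  assumes chain: "\<X> \<in> Chains (relation_of pair_le A)" and A: "snd ` A \<subseteq> \<A>"
  shows "subset.chain \<A> (snd ` \<X>)"
proof -
  have "snd x \<subseteq> snd y \<or> snd y \<subseteq> snd x" if "x \<in> \<X>" "y \<in> \<X>" for x y
    using Chains_pair_leD(2)[OF chain that] unfolding pair_le_def by blast
  then show ?thesis unfolding subset_chain_def using Chains_pair_leD(1)[OF chain] A by blast
qed

lemma Chains_pair_le_no_max:
  assumes chain: "\<X> \<in> Chains (relation_of pair_le A)"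
    and no_max: "\<not> (\<exists>m\<in>\<X>. \<forall>x\<in>\<X>. pair_le x m)" and x: "x \<in> \<X>"
  obtains y where "y \<in> \<X>" "fst x \<subset> fst y"
proof -
  obtain y where y: "y \<in> \<X>" "\<not> pair_le y x" using no_max x by blast
  then have "pair_le x y" "x \<noteq> y"
    using Chains_pair_leD(2)[OF chain x] unfolding pair_le_def by blast+
  then show ?thesis using that y(1) unfolding pair_le_def by blast
qed

lemma Chains_pair_le_Union:
  assumes "\<X> \<in> Chains (relation_of pair_le A)" "\<not> (\<exists>m\<in>\<X>. \<forall>x\<in>\<X>. pair_le x m)" "x \<in> \<X>"
  shows "pair_le x (\<Union>(fst ` \<X>), \<Union>(snd ` \<X>))"
proof -
  obtain y where "y \<in> \<X>" "fst x \<subset> fst y" by (rule Chains_pair_le_no_max[OF assms])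
  then show ?thesis using assms(3) unfolding pair_le_def by auto
qed

lemma card_of_Domain_Chains_pair_le:
  fixes \<X> :: "('b set \<times> ('c \<times> 'd) set) set"
  assumes chain: "\<X> \<in> Chains (relation_of pair_le A)" "\<not> (\<exists>m\<in>\<X>. \<forall>x\<in>\<X>. pair_le x m)"
    and r: "Cinfinite r" and fst: "|\<Union>(fst ` \<X>)| \<le>o r" and snd: "\<And>x. x \<in> \<X> \<Longrightarrow> |Domain (snd x)| \<le>o r"
  shows "|Domain (\<Union>(snd ` \<X>))| \<le>o r"
proof -
  obtain X where X: "\<And>p. p \<in> \<Union>(fst ` \<X>) \<Longrightarrow> X p \<in> \<X> \<and> p \<in> fst (X p)"
    using bchoice[of "\<Union>(fst ` \<X>)" "\<lambda>p x. x \<in> \<X> \<and> p \<in> fst x"] by blast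
  have cover: "Domain (\<Union>(snd ` \<X>)) \<subseteq> (\<Union>p\<in>\<Union>(fst ` \<X>). Domain (snd (X p)))"
  proof
    fix z assume "z \<in> Domain (\<Union>(snd ` \<X>))"
    then obtain x where x: "x \<in> \<X>" "z \<in> Domain (snd x)" by blast
    obtain y where "y \<in> \<X>" "fst x \<subset> fst y" by (rule Chains_pair_le_no_max[OF chain x(1)])
    then obtain p where p: "p \<in> \<Union>(fst ` \<X>)" "p \<notin> fst x" by blast
    have "pair_le x (X p)"
      using Chains_pair_leD(2)[OF chain(1) x(1), of "X p"] X[OF p(1)] p(2) unfolding pair_le_def
      by blast
    then have "z \<in> Domain (snd (X p))" using x(2) unfolding pair_le_def by blast
    then show "z \<in> (\<Union>p\<in>\<Union>(fst ` \<X>). Domain (snd (X p)))" using p(1) by blast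
  qed
  have "|\<Union>p\<in>\<Union>(fst ` \<X>). Domain (snd (X p))| \<le>o r"
    by (rule UNION_Cinfinite_bound[OF fst _ r]) (use X snd in blast)
  then show ?thesis using card_of_mono1[OF cover] ordLeq_transitive by blast
qed

locale simple_independence_cardinals = simple_independence K kbar C ind
  for K :: "('f, 'r, 'a) aec" and kbar :: "'a rel" and C :: "('f, 'r, 'a) struct"
    and ind :: "('f, 'r, 'a) indrel" +
  fixes \<mu> LS kap ell :: "'a rel"
  assumes LS: "LST_bound K LS" "LS \<le>o \<mu>" and \<mu>: "Cinfinite \<mu>" "\<mu> <o kbar"
    and local_char: "local_character_pair K kbar C ind kap ell"
    and kap: "kap \<le>o \<mu>" and ell: "cexp_less \<mu> ell =o \<mu>"
begin

abbreviation \<chi> :: "('a \<Rightarrow> bool) rel" where "\<chi> \<equiv> ctwo ^c \<mu>"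

lemma Cinfinite_\<chi>: "Cinfinite \<chi>"
  using Cinfinite_cexp \<mu> ordLeq_refl Card_order_ctwo by blast

lemma \<mu>_le_\<chi>: "\<mu> \<le>o \<chi>"
  using ordLess_ctwo_cexp \<mu>(1) ordLess_imp_ordLeq by blast

lemma \<chi>_cexp_\<mu>: "\<chi> ^c \<mu> \<le>o \<chi>"
  using cexp_cexp_same[OF \<mu>(1) Card_order_ctwo] ordIso_iff_ordLeq by blast

lemma \<chi>_less_kbar: "\<chi> <o kbar"
  using strong_limit_kbar \<mu> unfolding strong_limit_def by blast

lemma small_if_le_\<chi>: "A \<subseteq> univ C \<Longrightarrow> |A| \<le>o \<chi> \<Longrightarrow> small A"
  unfolding small_set_def using \<chi>_less_kbar ordLeq_ordLess_trans by blast

lemma small_if_le_\<mu>: "A \<subseteq> univ C \<Longrightarrow> |A| \<le>o \<mu> \<Longrightarrow> small A"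
  unfolding small_set_def using \<mu>(2) ordLeq_ordLess_trans by blast

lemma submodel_hull_\<mu>:
  assumes "submodel W" "A \<subseteq> W" "|A| \<le>o \<mu>"
  obtains B where "submodel B" "A \<subseteq> B" "B \<subseteq> W" "|B| \<le>o \<mu>"
  using submodel_hull_exists[OF LS \<mu>(1) assms] .

lemma submodel_hull_\<chi>:
  assumes "A \<subseteq> univ C" "|A| \<le>o \<chi>"
  obtains B where "submodel B" "A \<subseteq> B" "|B| \<le>o \<chi>"
  using submodel_hull_exists[OF LS(1) ordLeq_transitive[OF LS(2) \<mu>_le_\<chi>] Cinfinite_\<chi>
      submodel_univ_C assms] that
  by blast

lemma closed_submodel_exists:
  assumes M: "submodel M" "|M| \<le>o \<chi>"
    and P: "\<And>R. submodel R \<Longrightarrow> |R| \<le>o \<mu> \<Longrightarrow> P R \<subseteq> univ C \<and> |P R| \<le>o \<chi>"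
  obtains W where "submodel W" "M \<subseteq> W" "|W| \<le>o \<chi>"
    "\<And>R. R \<in> submodels_upto \<mu> W \<Longrightarrow> P R \<subseteq> W"
proof -
  have univ: "\<Union>(Collect submodel) = univ C" using submodel_subset_univ submodel_univ_C by blast
  let ?F = "\<lambda>R. if submodel R then P R else {}"
  have F: "?F R \<subseteq> univ C \<and> |?F R| \<le>o \<chi>" if "R \<in> subsets_upto \<mu> (univ C)" for R
    using P that Card_order_empty[OF Card_order_cexp] unfolding subsets_upto_def by auto
  have hull: "\<exists>B\<in>Collect submodel. A \<subseteq> B \<and> |B| \<le>o \<chi>" if "A \<subseteq> univ C" "|A| \<le>o \<chi>" for A
    using submodel_hull_\<chi>[OF that] by blast
  obtain W where W: "submodel W" "M \<subseteq> W" "|W| \<le>o \<chi>"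
    and closed: "\<And>R. R \<in> subsets_upto \<mu> W \<Longrightarrow> ?F R \<subseteq> W"
    using closed_superset_exists[of \<mu> \<chi> "Collect submodel" ?F M, unfolded univ,
        OF \<mu>(1) Cinfinite_\<chi> \<chi>_cexp_\<mu> _ hull F submodel_subset_univ[OF M(1)] M(2)]
      submodel_Union_chain
    by (metis mem_Collect_eq)
  have "P R \<subseteq> W" if "R \<in> submodels_upto \<mu> W" for R
    using closed[of R] that unfolding submodels_upto_def by simp
  then show ?thesis by (rule that[OF W])
qed

definition realizes_nonforking :: "'a set \<Rightarrow> 'a \<Rightarrow> 'a set \<Rightarrow> (unit, 'a) gtype set \<Rightarrow> bool" where
  "realizes_nonforking R a P D \<longleftrightarrow>
     a \<in> univ C \<and> indep {a} R P \<and> (\<forall>p\<in>D. fst p \<subseteq> P \<and> realizes K C a p)"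

lemma realizes_nonforking_consistent: "realizes_nonforking R a P D \<Longrightarrow> consistent K C D"
  unfolding realizes_nonforking_def consistent_def by blast

lemma realizes_nonforking_eqtp1:
  assumes R: "submodel R" "R \<subseteq> P" "small P" and a: "realizes_nonforking R a P D" "eqtp1 P a a'"
  shows "realizes_nonforking R a' P D"
proof -
  have aC: "a \<in> univ C" using a(1) unfolding realizes_nonforking_def by blast
  then have "a' \<in> univ C" using eqtp_in_univ[OF a(2)] by blast
  moreover have "indep {a'} R P"
    using indep_eqtp1[OF R aC _ a(2)] a(1) unfolding realizes_nonforking_def by blast
  moreover have "realizes K C a' p" if "p \<in> D" for p
    using realizes_eqtp[OF _ aC a(2) _ small_subset_univ[OF R(3)]] a(1) that
    unfolding realizes_nonforking_def by blast
  ultimately show ?thesis using a(1) unfolding realizes_nonforking_def by blast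
qed

lemma realizes_nonforking_Union_chain:
  assumes R: "submodel R" and P: "submodel (\<Union>(P ` \<X>))" "small (\<Union>(P ` \<X>))"
    and chain: "subset.chain UNIV (P ` \<X>)" "\<X> \<noteq> {}"
    and a: "\<And>x. x \<in> \<X> \<Longrightarrow> R \<subseteq> P x \<and> realizes_nonforking R a (P x) (D x)"
  shows "realizes_nonforking R a (\<Union>(P ` \<X>)) (\<Union>(D ` \<X>))"
proof -
  have aC: "a \<in> univ C" and RP: "R \<subseteq> \<Union>(P ` \<X>)"
    using a chain(2) unfolding realizes_nonforking_def by blast+
  have "indep {a} R A" if A: "finite A" "A \<subseteq> \<Union>(P ` \<X>)" for A
  proof -
    obtain x where x: "x \<in> \<X>" "A \<subseteq> P x"
      using finite_subset_Union_chain[OF A _ chain(1)] chain(2) by blast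
    have "small (P x)" by (rule small_subset[OF P(2)]) (use x(1) in blast)
    then show ?thesis
      using indep_mono[OF R small_subset[OF P(2) RP] small_singleton[OF aC], of "P x" "{a}" A]
        a[OF x(1)] x(2)
      unfolding realizes_nonforking_def by blast
  qed
  then have "indep {a} R (\<Union>(P ` \<X>))" by (rule indep_finite_character[OF R RP P aC])
  moreover have "\<forall>p\<in>\<Union>(D ` \<X>). fst p \<subseteq> \<Union>(P ` \<X>) \<and> realizes K C a p"
    using a unfolding realizes_nonforking_def by blast
  ultimately show ?thesis unfolding realizes_nonforking_def using aC by blast
qed

definition independent_over :: "'a set \<Rightarrow> 'a set \<Rightarrow> 'a \<Rightarrow> 'a set \<Rightarrow> bool" where
  "independent_over R P c N \<longleftrightarrow> c \<in> univ C \<and> N \<subseteq> univ C \<and> |N| \<le>o \<mu> \<and>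
     indep {c} R (N \<union> R) \<and> indep (N \<union> R) R P"

lemma independent_over_mono:
  assumes "independent_over R W c N" "P \<subseteq> W" and R: "submodel R" "|R| \<le>o \<mu>" and W: "small W"
  shows "independent_over R P c N"
proof -
  have "small R" "small (N \<union> R)"
    using small_if_le_\<mu> submodel_subset_univ[OF R(1)] R(2) assms(1) small_Un
    unfolding independent_over_def by blast+
  then have "indep (N \<union> R) R P"
    using indep_mono[OF R(1), of "N \<union> R" W "N \<union> R" P] W assms(1,2) unfolding independent_over_def
    by blast
  then show ?thesis using assms(1) unfolding independent_over_def by blast
qed

lemma realizes_nonforking_insert:
  assumes a: "realizes_nonforking R a P D"
    and R: "submodel R" "|R| \<le>o \<mu>" and P: "submodel P" "|P| \<le>o \<chi>" "R \<subseteq> P"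
    and c: "independent_over R P c N" "eqtp1 R c a"
  obtains Q d where "submodel Q" "P \<subseteq> Q" "|Q| \<le>o \<chi>" "eqtp1 P d a"
    "realizes_nonforking R d Q (insert (tp1 K C c N) D)"
proof -
  have aC: "a \<in> univ C" "indep {a} R P" and D: "\<And>p. p \<in> D \<Longrightarrow> fst p \<subseteq> P \<and> realizes K C a p"
    using a unfolding realizes_nonforking_def by blast+
  have N: "c \<in> univ C" "N \<subseteq> univ C" "|N| \<le>o \<mu>" "indep {c} R (N \<union> R)" "indep (N \<union> R) R P"
    using c(1) unfolding independent_over_def by blast+
  have PC: "P \<subseteq> univ C" by (rule submodel_subset_univ[OF P(1)])
  have "|N \<union> P| \<le>o \<chi>"
    by (intro Un_Cinfinite_bound ordLeq_transitive[OF N(3) \<mu>_le_\<chi>] P(2) Cinfinite_\<chi>)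
  then obtain Q where Q: "submodel Q" "N \<union> P \<subseteq> Q" "|Q| \<le>o \<chi>"
    using submodel_hull_\<chi>[of "N \<union> P"] N(2) PC by blast
  have smallQ: "small Q" and NRPQ: "(N \<union> R) \<union> P \<subseteq> Q"
    using small_if_le_\<chi>[OF submodel_subset_univ[OF Q(1)] Q(3)] Q(2) P(3) by blast+
  obtain d where d: "d \<in> univ C" "eqtp1 (N \<union> R) d c" "eqtp1 P d a" "indep {d} R Q"
    using nonforking_amalgamation1[OF R(1) Un_upper2 P(3) Q(1) smallQ NRPQ N(5,1,4) aC c(2)] .
  have "eqtp1 P a d" using eqtp1_sym[OF d(3,1) PC] .
  then have "fst p \<subseteq> Q \<and> realizes K C d p" if "p \<in> D" for p
    using D[OF that] realizes_eqtp[OF _ aC(1) _ _ PC] Q(2) by blast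
  moreover have "eqtp1 N c d" using eqtp1_sym[OF eqtp_mono[OF d(2) Un_upper1] d(1) N(2)] .
  then have "realizes K C d (tp1 K C c N)" using realizes_tp1_iff[OF d(1) N(1,2)] by blast
  ultimately have "realizes_nonforking R d Q (insert (tp1 K C c N) D)"
    unfolding realizes_nonforking_def using d(1,4) Q(2) by auto
  then show ?thesis using that Q d(3) by blast
qed

definition nonforking_types :: "'a set \<Rightarrow> (unit, 'a) gtype set" where
  "nonforking_types M = {tp1 K C a N |a N.
     a \<in> univ C \<and> submodel N \<and> |N| \<le>o \<mu> \<and> M \<subseteq> N \<and> indep {a} M N}"

lemma independence_base_exists:
  assumes M: "submodel M" "|M| \<le>o \<mu>" and N: "N \<subseteq> univ C" "|N| \<le>o \<mu>"
    and W: "submodel W" "small W" "M \<subseteq> W"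
  obtains R where "submodel R" "M \<subseteq> R" "R \<subseteq> W" "|R| \<le>o \<mu>" "indep (N \<union> R) R W"
proof -
  have smallN: "small N" by (rule small_if_le_\<mu>[OF N])
  obtain R0 where R0: "R0 \<subseteq> W" "submodel R0" "|R0| \<le>o \<mu>" "indep N R0 W"
    using local_character_bounded[OF local_char \<mu>(1) kap ell smallN N(2) W(1,2)] .
  have "|R0 \<union> M| \<le>o \<mu>" by (intro Un_Cinfinite_bound R0(3) M(2) \<mu>(1))
  then obtain R where R: "submodel R" "R0 \<union> M \<subseteq> R" "R \<subseteq> W" "|R| \<le>o \<mu>"
    using submodel_hull_\<mu>[OF W(1), of "R0 \<union> M"] R0(1) W(3) by blast
  have "indep N R W" using indep_base_mono[OF R0(2) R(1) smallN W(2) _ R(3) R0(4)] R(2) by blast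
  then have "indep (N \<union> R) R (W \<union> R)"
    using indep_normal[OF R(1) small_subset[OF W(2) R(3)] smallN W(2)] by blast
  moreover have "W \<union> R = W" using R(3) by blast
  ultimately show ?thesis using that R by auto
qed

lemma nonforking_type_realization_over:
  assumes a: "a \<in> univ C" "indep {a} M N" and M: "submodel M" "M \<subseteq> N" "M \<subseteq> R"
    and N: "submodel N" "|N| \<le>o \<mu>" and R: "submodel R" "|R| \<le>o \<mu>"
  obtains c where "c \<in> univ C" "tp1 K C a N = tp1 K C c N" "indep {c} R (N \<union> R)"
proof -
  have "N \<union> R \<subseteq> univ C" "|N \<union> R| \<le>o \<mu>"
    using N R submodel_subset_univ Un_Cinfinite_bound \<mu>(1) by blast+
  then obtain Q where Q: "submodel Q" "N \<union> R \<subseteq> Q" "|Q| \<le>o \<mu>"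
    using submodel_hull_\<mu>[OF submodel_univ_C] by blast
  have small: "small Q" "small N" "small R"
    using small_if_le_\<mu> submodel_subset_univ Q(1,3) N R by blast+
  have NQ: "N \<subseteq> Q" and RQ: "R \<subseteq> Q" using Q(2) by blast+
  obtain c where c: "c \<in> univ C" "eqtp1 N c a" "indep {c} N Q"
    using nonforking_extension1[OF a(1) N(1) NQ Q(1) small(1)] .
  have ac: "eqtp1 N a c" using eqtp1_sym[OF c(2,1) submodel_subset_univ[OF N(1)]] .
  have "indep {c} M N" using indep_eqtp1[OF M(1,2) small(2) a ac] .
  then have "indep {c} M Q"
    using indep_trans[OF M(1) N(1) small(2) small_singleton[OF c(1)] small(1) M(2) _ c(3)] by blast
  then have "indep {c} R Q"
    using indep_base_mono[OF M(1) R(1) small_singleton[OF c(1)] small(1) M(3) RQ] by blast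
  then have "indep {c} R (N \<union> R)"
    using indep_mono[OF R(1) small(3) small_singleton[OF c(1)] small(1) _ subset_refl Q(2)] by blast
  moreover have "tp1 K C a N = tp1 K C c N"
    using tp1_eq_iff[OF a(1) c(1) submodel_subset_univ[OF N(1)]] ac by blast
  ultimately show ?thesis using that c(1) by blast
qed

lemma nonforking_type_independent_over:
  assumes p: "p \<in> nonforking_types M" and M: "submodel M" "|M| \<le>o \<mu>"
    and W: "submodel W" "small W" "M \<subseteq> W"
  obtains R c N where "R \<in> submodels_upto \<mu> W" "p = tp1 K C c N" "independent_over R W c N"
proof -
  obtain a N where aN: "p = tp1 K C a N" "a \<in> univ C" "indep {a} M N"
    and N: "submodel N" "|N| \<le>o \<mu>" "M \<subseteq> N"
    using p unfolding nonforking_types_def by blast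
  obtain R where R: "submodel R" "M \<subseteq> R" "R \<subseteq> W" "|R| \<le>o \<mu>" "indep (N \<union> R) R W"
    using independence_base_exists[OF M submodel_subset_univ[OF N(1)] N(2) W] .
  obtain c where "c \<in> univ C" "tp1 K C a N = tp1 K C c N" "indep {c} R (N \<union> R)"
    using nonforking_type_realization_over[OF aN(2,3) M(1) N(3) R(2) N(1,2) R(1,4)] .
  then have "p = tp1 K C c N" "independent_over R W c N"
    using aN(1) submodel_subset_univ[OF N(1)] N(2) R(5) unfolding independent_over_def by auto
  moreover have "R \<in> submodels_upto \<mu> W" using R(1,3,4) submodels_upto_iff by blast
  ultimately show ?thesis using that by blast
qed

end

locale sparse_type_family = simple_independence_cardinals K kbar C ind \<mu> LS kap ell
  for K :: "('f, 'r, 'a) aec" and kbar :: "'a rel" and C :: "('f, 'r, 'a) struct"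
    and ind :: "('f, 'r, 'a) indrel" and \<mu> LS kap ell :: "'a rel" +
  fixes G :: "(unit, 'a) gtype set"
  assumes G_small: "|G| <o kbar"
    and G_sparse: "\<And>D. D \<subseteq> G \<Longrightarrow> consistent K C D \<Longrightarrow> |D| \<le>o \<chi>"
begin

text \<open>A strong map \<open>H\<close> that fixes \<open>R\<close> stands for the copy \<open>Range H\<close> of the model \<open>Domain H\<close>, and \<open>b\<close>
  for its preimages under the automorphisms extending \<open>H\<close>. Keeping \<open>b\<close> fixed and moving the models
  makes the types of these preimages a coherent family, so that unions of chains exist.\<close>

definition approximation :: "'a set \<Rightarrow> 'a \<Rightarrow> (unit, 'a) gtype set \<Rightarrow> ('a \<times> 'a) set \<Rightarrow> bool" where
  "approximation R b D H \<longleftrightarrow> D \<subseteq> G \<and> strong_map H \<and> Id_on R \<subseteq> H \<and> |Domain H| \<le>o \<chi> \<and>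
     (\<exists>g a. aut_extending H g \<and> g a = b \<and> realizes_nonforking R a (Domain H) D)"

lemma approximation_domain:
  assumes "approximation R b D H"
  shows "submodel (Domain H)" "|Domain H| \<le>o \<chi>" "small (Domain H)" "R \<subseteq> Domain H"
proof -
  show P: "submodel (Domain H)" "|Domain H| \<le>o \<chi>"
    using assms unfolding approximation_def strong_map_def by blast+
  show "small (Domain H)" by (rule small_if_le_\<chi>[OF submodel_subset_univ[OF P(1)] P(2)])
  show "R \<subseteq> Domain H" using assms unfolding approximation_def by blast
qed

lemma card_of_approximation:
  assumes "approximation R b D H"
  shows "|D| \<le>o \<chi>"
  using assms G_sparse realizes_nonforking_consistent unfolding approximation_def by blast

lemma approximation_preimage:
  assumes approx: "approximation R b D H" and R: "submodel R"
    and g: "aut_extending H g" "a \<in> univ C" "g a = b"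
  shows "realizes_nonforking R a (Domain H) D"
proof -
  obtain h c where h: "aut_extending H h" "h c = b" "realizes_nonforking R c (Domain H) D"
    using approx unfolding approximation_def by blast
  have "c \<in> univ C" using h(3) unfolding realizes_nonforking_def by blast
  then have "eqtp1 (Domain H) c a"
    using eqtp1_if_aut_extending[OF h(1) g(1)] submodel_subset_univ
      approximation_domain(1)[OF approx] g h(2) by blast
  then show ?thesis
    using realizes_nonforking_eqtp1[OF R approximation_domain(4,3)[OF approx] h(3)] by blast
qed

lemma approximation_Id_on:
  assumes R: "submodel R" "|R| \<le>o \<mu>" and b: "b \<in> univ C"
  shows "approximation R b {} (Id_on R)"
proof -
  have "small R" by (rule small_if_le_\<mu>[OF submodel_subset_univ[OF R(1)] R(2)])
  then have "realizes_nonforking R b R {}"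
    unfolding realizes_nonforking_def using indep_self b R(1) by blast
  moreover have "aut_extending (Id_on R) id" using aut_extending_Id_on aut_over_id by blast
  moreover have "|R| \<le>o \<chi>" using R(2) \<mu>_le_\<chi> ordLeq_transitive by blast
  ultimately show ?thesis unfolding approximation_def using strong_map_Id_on[OF R(1)] by auto
qed

lemma card_of_G_csum_\<chi>_less_kbar: "|G| +c \<chi> <o kbar"
proof -
  have "|Field \<chi>| <o kbar"
    using \<chi>_less_kbar card_of_Field_ordIso[OF Card_order_cexp] ordIso_ordLess_trans by blast
  then have "|G <+> Field \<chi>| <o kbar"
    using card_of_Plus_ordLess_infinite_Field G_small Cinfinite_kbar unfolding cinfinite_def
    by blast
  then show ?thesis unfolding csum_def by (simp add: Field_card_of)
qed

lemma strong_map_approximation_Union: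
  assumes chain: "\<X> \<in> Chains (relation_of pair_le {(D, H). approximation R b D H})" "\<X> \<noteq> {}"
    and no_max: "\<not> (\<exists>m\<in>\<X>. \<forall>x\<in>\<X>. pair_le x m)"
  shows "strong_map (\<Union>(snd ` \<X>))" and "|Domain (\<Union>(snd ` \<X>))| <o kbar"
proof -
  have strong: "subset.chain (Collect strong_map) (snd ` \<X>)"
    by (rule Chains_pair_le_snd[OF chain(1)]) (auto simp: approximation_def)
  have approx: "approximation R b (fst x) (snd x)" if "x \<in> \<X>" for x
    using Chains_pair_leD(1)[OF chain(1)] that by auto
  have le: "|G| \<le>o |G| +c \<chi>" "\<chi> \<le>o |G| +c \<chi>"
    using ordLeq_csum1[OF card_of_Card_order] ordLeq_csum2[OF Card_order_cexp] .
  have "|Domain (\<Union>(snd ` \<X>))| \<le>o |G| +c \<chi>"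
  proof (rule card_of_Domain_Chains_pair_le[OF chain(1) no_max])
    show "Cinfinite ( |G| +c \<chi>)" using Cinfinite_csum Cinfinite_\<chi> by blast
    have "\<Union>(fst ` \<X>) \<subseteq> G" using approx unfolding approximation_def by blast
    then show "|\<Union>(fst ` \<X>)| \<le>o |G| +c \<chi>" using card_of_mono1 le(1) ordLeq_transitive by blast
    show "|Domain (snd x)| \<le>o |G| +c \<chi>" if "x \<in> \<X>" for x
      using approximation_domain(2)[OF approx[OF that]] le(2) ordLeq_transitive by blast
  qed
  then show less: "|Domain (\<Union>(snd ` \<X>))| <o kbar"
    using card_of_G_csum_\<chi>_less_kbar ordLeq_ordLess_trans by blast
  show "strong_map (\<Union>(snd ` \<X>))"
    by (rule strong_map_Union_chain[OF strong _ less]) (use chain(2) in blast)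
qed

lemma approximation_Union_chain:
  assumes R: "submodel R" and b: "b \<in> univ C"
    and chain: "\<X> \<in> Chains (relation_of pair_le {(D, H). approximation R b D H})" "\<X> \<noteq> {}"
    and no_max: "\<not> (\<exists>m\<in>\<X>. \<forall>x\<in>\<X>. pair_le x m)"
  shows "approximation R b (\<Union>(fst ` \<X>)) (\<Union>(snd ` \<X>))"
proof -
  let ?D = "\<Union>(fst ` \<X>)" and ?H = "\<Union>(snd ` \<X>)"
  have approx: "approximation R b (fst x) (snd x)" if "x \<in> \<X>" for x
    using Chains_pair_leD(1)[OF chain(1)] that by auto
  have strong: "strong_map ?H" by (rule strong_map_approximation_Union[OF chain no_max])
  then obtain g where g: "aut_extending ?H g" and P: "submodel (Domain ?H)"
    unfolding strong_map_def by blast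
  have small: "small (Domain ?H)"
    by (rule small_submodel[OF P strong_map_approximation_Union(2)[OF chain no_max]])
  obtain h where h: "aut h" "\<forall>x\<in>univ C. h (g x) = x \<and> g (h x) = x"
    using aut_inverse[OF aut_extending_aut[OF g]] .
  have a: "h b \<in> univ C" "g (h b) = b" using h b aut_in_univ by auto
  have Domain: "Domain ?H = \<Union>((\<lambda>x. Domain (snd x)) ` \<X>)" by blast
  have "realizes_nonforking R (h b) (Domain ?H) ?D"
    unfolding Domain
  proof (rule realizes_nonforking_Union_chain[OF R])
    show "submodel (\<Union>((\<lambda>x. Domain (snd x)) ` \<X>))" "small (\<Union>((\<lambda>x. Domain (snd x)) ` \<X>))"
      using P small unfolding Domain .
    have "subset.chain UNIV (Domain ` snd ` \<X>)"
      by (rule subset_chain_image[OF Chains_pair_le_snd[OF chain(1) subset_UNIV] Domain_mono])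
        simp_all
    then show "subset.chain UNIV ((\<lambda>x. Domain (snd x)) ` \<X>)" by (simp add: image_image)
    fix x assume x: "x \<in> \<X>"
    have "aut_extending (snd x) g" by (rule aut_extending_mono[OF g]) (use x in blast)
    then show "R \<subseteq> Domain (snd x) \<and> realizes_nonforking R (h b) (Domain (snd x)) (fst x)"
      using approximation_preimage[OF approx[OF x] R] a approximation_domain(4)[OF approx[OF x]]
      by blast
  qed (rule chain(2))
  moreover have DG: "?D \<subseteq> G" using approx unfolding approximation_def by blast
  moreover have "|Domain ?H| \<le>o \<chi>"
  proof (rule card_of_Domain_Chains_pair_le[OF chain(1) no_max Cinfinite_\<chi>])
    show "|?D| \<le>o \<chi>" using G_sparse[OF DG realizes_nonforking_consistent] calculation(1) .
  qed (use approximation_domain(2)[OF approx] in blast)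
  moreover have "Id_on R \<subseteq> ?H" using approx chain(2) unfolding approximation_def by blast
  ultimately show ?thesis unfolding approximation_def using strong g a(2) by blast
qed

lemma maximal_approximation_exists:
  assumes R: "submodel R" "|R| \<le>o \<mu>" and b: "b \<in> univ C"
  obtains D H where "approximation R b D H"
    "\<And>D' H'. approximation R b D' H' \<Longrightarrow> D \<subseteq> D' \<Longrightarrow> H \<subseteq> H' \<Longrightarrow> D' = D"
proof -
  let ?A = "{(D, H). approximation R b D H}"
  have "\<exists>m\<in>?A. \<forall>x\<in>?A. pair_le m x \<longrightarrow> x = m"
  proof (rule predicate_Zorn[OF partial_order_pair_le])
    fix \<X> assume \<X>: "\<X> \<in> Chains (relation_of pair_le ?A)"
    consider "\<X> = {}" | m where "m \<in> \<X>" "\<forall>x\<in>\<X>. pair_le x m"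
      | "\<X> \<noteq> {}" "\<not> (\<exists>m\<in>\<X>. \<forall>x\<in>\<X>. pair_le x m)" by blast
    then show "\<exists>u\<in>?A. \<forall>x\<in>\<X>. pair_le x u"
    proof cases
      case 1
      then show ?thesis using approximation_Id_on[OF R b] by blast
    next
      case 2
      then show ?thesis using Chains_pair_leD(1)[OF \<X>] by blast
    next
      case 3
      then have "approximation R b (\<Union>(fst ` \<X>)) (\<Union>(snd ` \<X>))"
        by (intro approximation_Union_chain[OF R(1) b \<X>])
      then show ?thesis using Chains_pair_le_Union[OF \<X> 3(2)] by (intro bexI) auto
    qed
  qed
  then obtain D H where "approximation R b D H"
    and "\<forall>D' H'. approximation R b D' H' \<and> pair_le (D, H) (D', H') \<longrightarrow> D' = D \<and> H' = H"
    by auto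
  then show ?thesis using that unfolding pair_le_def by (metis fst_conv psubsetI snd_conv)
qed

lemma approximation_insert:
  assumes approx: "approximation R b D H" and R: "submodel R" "|R| \<le>o \<mu>"
    and c: "independent_over R (Domain H) c N" "eqtp1 R c b" and G: "tp1 K C c N \<in> G"
  obtains H' where "approximation R b (insert (tp1 K C c N) D) H'" "H \<subseteq> H'"
proof -
  note P = approximation_domain[OF approx]
  obtain g a where g: "aut_extending H g" "g a = b" and a: "realizes_nonforking R a (Domain H) D"
    using approx unfolding approximation_def by blast
  have aC: "a \<in> univ C" using a unfolding realizes_nonforking_def by blast
  have "aut_over R g"
    using aut_extending_mono[OF g(1)] aut_extending_Id_on approx unfolding approximation_def
    by blast
  then have "eqtp1 R a b" using g(2) eqtp1_iff by blast
  then have ca: "eqtp1 R c a"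
    using eqtp_trans[OF c(2)] eqtp1_sym[OF _ aC submodel_subset_univ[OF R(1)]] by blast
  obtain Q d where Q: "submodel Q" "Domain H \<subseteq> Q" "|Q| \<le>o \<chi>" and d: "eqtp1 (Domain H) d a"
    and real: "realizes_nonforking R d Q (insert (tp1 K C c N) D)"
    using realizes_nonforking_insert[OF a R P(1,2,4) c(1) ca] .
  obtain s where s: "aut_over (Domain H) s" "s d = a" using d unfolding eqtp1_iff by blast
  have gs: "aut (g \<circ> s)"
    using s(1) is_iso_comp aut_extending_aut[OF g(1)] unfolding aut_over_def by blast
  let ?H' = "(\<lambda>x. (x, (g \<circ> s) x)) ` Q"
  have Domain: "Domain ?H' = Q" by force
  have sub: "H \<subseteq> ?H'"
  proof (rule subrelI)
    fix x y assume xy: "(x, y) \<in> H"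
    then have "s x = x" "g x = y"
      using s(1) aut_extendingD[OF g(1)] unfolding aut_over_def by blast+
    then show "(x, y) \<in> ?H'" using xy Q(2) by force
  qed
  have "approximation R b (insert (tp1 K C c N) D) ?H'"
    unfolding approximation_def Domain
  proof (intro conjI exI)
    show "insert (tp1 K C c N) D \<subseteq> G" "Id_on R \<subseteq> ?H'"
      using approx G sub unfolding approximation_def by blast+
    show "strong_map ?H'" "aut_extending ?H' (g \<circ> s)"
      using strong_map_graph[OF Q(1) gs] aut_extending_graph[OF gs] .
    show "(g \<circ> s) d = b" using s(2) g(2) by simp
  qed (fact Q(3) real)+
  then show ?thesis using that sub by blast
qed

definition absorbing ::
  "'a set \<Rightarrow> (unit, 'a) gtype set \<Rightarrow> 'a set \<Rightarrow> (unit, 'a) gtype set \<Rightarrow> bool" where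
  "absorbing R T P D \<longleftrightarrow> P \<subseteq> univ C \<and> |P| \<le>o \<chi> \<and> |D| \<le>o \<chi> \<and>
     (\<forall>c N. tp1 K C c R \<in> T \<and> independent_over R P c N \<and> tp1 K C c N \<in> G \<longrightarrow> tp1 K C c N \<in> D)"

lemma absorbing_single_type_exists:
  assumes R: "submodel R" "|R| \<le>o \<mu>" and q: "q \<in> types_over R"
  shows "\<exists>P D. absorbing R {q} P D"
proof -
  obtain b where b: "b \<in> univ C" "q = tp1 K C b R" using q unfolding types_over_def by blast
  obtain D H where DH: "approximation R b D H"
    and max: "\<And>D' H'. approximation R b D' H' \<Longrightarrow> D \<subseteq> D' \<Longrightarrow> H \<subseteq> H' \<Longrightarrow> D' = D"
    using maximal_approximation_exists[OF R b(1)] by blast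
  have "tp1 K C c N \<in> D"
    if c: "tp1 K C c R = q" "independent_over R (Domain H) c N" "tp1 K C c N \<in> G" for c N
  proof -
    have "eqtp1 R c b"
      using c(1,2) b tp1_eq_iff submodel_subset_univ[OF R(1)] unfolding independent_over_def
      by blast
    then obtain H' where "approximation R b (insert (tp1 K C c N) D) H'" "H \<subseteq> H'"
      using approximation_insert[OF DH R c(2) _ c(3)] by blast
    then show ?thesis using max by blast
  qed
  then have "absorbing R {q} (Domain H) D"
    unfolding absorbing_def
    using approximation_domain(2)[OF DH] submodel_subset_univ[OF approximation_domain(1)[OF DH]]
      card_of_approximation[OF DH]
    by blast
  then show ?thesis by blast
qed

lemma absorbing_types_over_exists:
  assumes R: "submodel R" "|R| \<le>o \<mu>"
  shows "\<exists>P D. absorbing R (types_over R) P D"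
proof -
  obtain P D where PD: "\<And>q. q \<in> types_over R \<Longrightarrow> absorbing R {q} (P q) (D q)"
    using absorbing_single_type_exists[OF R] by metis
  let ?P = "\<Union>q\<in>types_over R. P q"
  have types: "|types_over R| \<le>o \<chi>"
    by (rule card_of_types_over[OF LS \<mu> submodel_subset_univ[OF R(1)] R(2)])
  then have card: "|?P| \<le>o \<chi>" "|\<Union>q\<in>types_over R. D q| \<le>o \<chi>"
    using UNION_Cinfinite_bound[OF types _ Cinfinite_\<chi>] PD unfolding absorbing_def by blast+
  have P: "?P \<subseteq> univ C" using PD unfolding absorbing_def by blast
  have "tp1 K C c N \<in> D (tp1 K C c R)"
    if c: "tp1 K C c R \<in> types_over R" "independent_over R ?P c N" "tp1 K C c N \<in> G" for c N
  proof -
    have "independent_over R (P (tp1 K C c R)) c N"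
      by (rule independent_over_mono[OF c(2) _ R small_if_le_\<chi>[OF P card(1)]]) (use c(1) in blast)
    then show ?thesis using PD[OF c(1)] c(3) unfolding absorbing_def by blast
  qed
  then have "absorbing R (types_over R) ?P (\<Union>q\<in>types_over R. D q)"
    unfolding absorbing_def using P card by blast
  then show ?thesis by blast
qed

lemma card_of_nonforking_types:
  assumes M: "submodel M" "|M| \<le>o \<mu>" and G: "G \<subseteq> nonforking_types M"
  shows "|G| \<le>o \<chi>"
proof -
  obtain P D where PD: "\<And>R. submodel R \<Longrightarrow> |R| \<le>o \<mu> \<Longrightarrow> absorbing R (types_over R) (P R) (D R)"
    using absorbing_types_over_exists by metis
  have "|M| \<le>o \<chi>" using M(2) \<mu>_le_\<chi> ordLeq_transitive by blast
  then obtain W where W: "submodel W" "M \<subseteq> W" "|W| \<le>o \<chi>"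
    and closed: "\<And>R. R \<in> submodels_upto \<mu> W \<Longrightarrow> P R \<subseteq> W"
    using closed_submodel_exists[of M P] M(1) PD unfolding absorbing_def by metis
  have smallW: "small W" by (rule small_if_le_\<chi>[OF submodel_subset_univ[OF W(1)] W(3)])
  have "p \<in> (\<Union>R\<in>submodels_upto \<mu> W. D R)" if p: "p \<in> G" for p
  proof -
    obtain R c N where R: "R \<in> submodels_upto \<mu> W"
      and c: "p = tp1 K C c N" "independent_over R W c N"
      using nonforking_type_independent_over[OF subsetD[OF G p] M W(1) smallW W(2)] .
    have R': "submodel R" "|R| \<le>o \<mu>" using R submodels_upto_iff by blast+
    have "independent_over R (P R) c N"
      by (rule independent_over_mono[OF c(2) closed[OF R] R' smallW])
    moreover have "tp1 K C c R \<in> types_over R"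
      using c(2) unfolding independent_over_def types_over_def by blast
    ultimately have "p \<in> D R" using PD[OF R'] p c(1) unfolding absorbing_def by blast
    then show ?thesis using R by blast
  qed
  then have "G \<subseteq> (\<Union>R\<in>submodels_upto \<mu> W. D R)" by blast
  moreover have "|\<Union>R\<in>submodels_upto \<mu> W. D R| \<le>o \<chi>"
  proof (rule card_of_UN_subsets_upto_bound[OF W(3) Cinfinite_\<chi> \<chi>_cexp_\<mu> _ submodels_upto_subset])
    show "|D R| \<le>o \<chi>" if "R \<in> submodels_upto \<mu> W" for R
      using PD that submodels_upto_iff unfolding absorbing_def by blast
  qed (use \<mu>(1) in blast)
  ultimately show ?thesis using card_of_mono1 ordLeq_transitive by blast
qed

end

section \<open>Bounding the number of types\<close>

context simple_independence_cardinals
begin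

lemma card_of_nonforking_types_if_inconsistent:
  assumes M: "submodel M" "|M| \<le>o \<mu>" and \<Gamma>: "\<Gamma> \<subseteq> nonforking_types M"
    and incons: "\<And>\<Delta>. \<Delta> \<subseteq> \<Gamma> \<Longrightarrow> cardSuc \<chi> \<le>o |\<Delta>| \<Longrightarrow> \<not> consistent K C \<Delta>"
  shows "|\<Gamma>| \<le>o \<chi>"
proof (rule ccontr)
  assume "\<not> |\<Gamma>| \<le>o \<chi>"
  then obtain G where G: "G \<subseteq> \<Gamma>" "|G| =o cardSuc \<chi>"
    by (rule subset_of_card_cardSuc[OF Card_order_cexp])
  have "|G| <o kbar"
    using G(2) strong_limit_cardSuc[OF strong_limit_kbar Card_order_cexp \<chi>_less_kbar]
      ordIso_ordLess_trans by blast
  moreover have "|D| \<le>o \<chi>" if "D \<subseteq> G" "consistent K C D" for D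
    using incons[of D] that G(1)
      Card_order_ordLeq_or_ordLess[OF cardSuc_Card_order card_of_Card_order]
      cardSuc_ordLeq_ordLess[OF _ card_of_Card_order] Card_order_cexp
    by blast
  ultimately interpret sparse_type_family K kbar C ind \<mu> LS kap ell G by unfold_locales
  have "|G| \<le>o \<chi>" using card_of_nonforking_types[OF M] G(1) \<Gamma> by blast
  then have "cardSuc \<chi> \<le>o \<chi>" using G(2) ordIso_symmetric ordIso_ordLeq_trans by blast
  then show False using cardSuc_greater[OF Card_order_cexp] not_ordLess_ordLeq by blast
qed

lemma S_le_subset_nonforking_types:
  assumes M: "leK K M C"
  shows "S_le K C M \<mu> \<subseteq> (\<Union>B\<in>submodels_upto (kap +c cone) (univ M). nonforking_types B)"
proof
  fix p assume "p \<in> S_le K C M \<mu>"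
  then obtain a N where a: "a \<in> univ C" "p = tp1 K C a (univ N)"
    and N: "leK K N M" "|univ N| \<le>o \<mu>"
    unfolding S_le_def by blast
  have sN: "submodel (univ N)" using leK_trans[OF N(1) M] by (rule submodel_univ)
  have "small (univ N)" by (rule small_if_le_\<mu>[OF submodel_subset_univ[OF sN] N(2)])
  then obtain B where B: "B \<subseteq> univ N" "submodel B" "|B| \<le>o kap +c cone" "indep {a} B (univ N)"
    by (rule local_character_singleton[OF local_char a(1) sN])
  have "B \<in> submodels_upto (kap +c cone) (univ M)"
    using B(1-3) leK_univ_subset[OF N(1)] submodels_upto_iff by blast
  moreover have "p \<in> nonforking_types B"
    using a sN N(2) B(1,4) unfolding nonforking_types_def by blast
  ultimately show "p \<in> (\<Union>B\<in>submodels_upto (kap +c cone) (univ M). nonforking_types B)" by blast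
qed

lemma card_of_inconsistent_types:
  assumes M: "leK K M C" "|univ M| =o lam" and lam: "Cinfinite lam" and kap_ne: "Field kap \<noteq> {}"
    and \<Gamma>: "\<Gamma> \<subseteq> S_le K C M \<mu>"
    and incons: "\<And>\<Delta>. \<Delta> \<subseteq> \<Gamma> \<Longrightarrow> cardSuc \<chi> \<le>o |\<Delta>| \<Longrightarrow> \<not> consistent K C \<Delta>"
  shows "|\<Gamma>| \<le>o (lam ^c kap) +c \<chi>"
proof -
  let ?r = "(lam ^c kap) +c \<chi>"
  let ?I = "submodels_upto (kap +c cone) (univ M)"
  have card_kap: "Card_order kap" using local_char unfolding local_character_pair_def by blast
  have "cone \<le>o \<mu>" using cone_ordLeq_Cnotzero Cinfinite_Cnotzero \<mu>(1) by blast
  then have kap_\<mu>: "kap +c cone \<le>o \<mu>"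
    using csum_cinfinite_bound kap card_kap Card_order_cone \<mu>(1) by blast
  have "|?I| \<le>o |subsets_upto (kap +c cone) (univ M)|"
    by (rule card_of_mono1[OF submodels_upto_subset])
  also have "|subsets_upto (kap +c cone) (univ M)| \<le>o |univ M| ^c (kap +c cone)"
    by (rule card_of_subsets_upto[OF Card_order_csum])
  also have "|univ M| ^c (kap +c cone) \<le>o lam ^c (kap +c cone)"
    using cexp_mono1 M(2) Card_order_csum ordIso_iff_ordLeq by blast
  also have "lam ^c (kap +c cone) \<le>o lam ^c kap" by (rule cexp_csum_cone[OF lam card_kap kap_ne])
  also have "lam ^c kap \<le>o ?r" by (rule ordLeq_csum1[OF Card_order_cexp])
  finally have I: "|?I| \<le>o ?r" .
  have "|\<Gamma> \<inter> nonforking_types B| \<le>o ?r" if "B \<in> ?I" for B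
  proof -
    have "submodel B" "|B| \<le>o \<mu>"
      using that kap_\<mu> ordLeq_transitive submodels_upto_iff by blast+
    then have "|\<Gamma> \<inter> nonforking_types B| \<le>o \<chi>"
      by (rule card_of_nonforking_types_if_inconsistent) (use incons in auto)
    then show ?thesis using ordLeq_csum2[OF Card_order_cexp] ordLeq_transitive by blast
  qed
  then have "|\<Union>B\<in>?I. \<Gamma> \<inter> nonforking_types B| \<le>o ?r"
    by (intro UNION_Cinfinite_bound[OF I] Cinfinite_csum) (use Cinfinite_\<chi> in blast)+
  moreover have "\<Gamma> \<subseteq> (\<Union>B\<in>?I. \<Gamma> \<inter> nonforking_types B)"
    using \<Gamma> S_le_subset_nonforking_types[OF M(1)] by blast
  ultimately show ?thesis using card_of_mono1 ordLeq_transitive by blast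
qed

lemma NT_ordLeq:
  assumes "Cinfinite lam" "Field kap \<noteq> {}"
  shows "NT K C \<mu> lam (cardSuc \<chi>) \<le>o (lam ^c kap) +c \<chi>"
  unfolding NT_def
proof (rule card_sup_ordLeq)
  fix r assume "r \<in> {|\<Gamma>| | \<Gamma>. \<exists>M. leK K M C \<and> |univ M| =o lam \<and> \<Gamma> \<subseteq> S_le K C M \<mu> \<and>
     (\<forall>\<Delta>\<subseteq>\<Gamma>. cardSuc \<chi> \<le>o |\<Delta>| \<longrightarrow> \<not> consistent K C \<Delta>)}"
  then obtain \<Gamma> M where "r = |\<Gamma>|" and M: "leK K M C" "|univ M| =o lam" and \<Gamma>: "\<Gamma> \<subseteq> S_le K C M \<mu>"
    "\<forall>\<Delta>\<subseteq>\<Gamma>. cardSuc \<chi> \<le>o |\<Delta>| \<longrightarrow> \<not> consistent K C \<Delta>" by blast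
  then show "r \<le>o (lam ^c kap) +c \<chi>" using card_of_inconsistent_types[OF M assms \<Gamma>(1)] by blast
qed (auto simp: card_of_Card_order Card_order_csum)

end

theorem theorem6p2:
  fixes K :: "('f, 'r, 'a) aec"
    and C :: "('f, 'r, 'a) struct"
    and ind :: "('f, 'r, 'a) indrel"
    and kbar LS \<mu> lam kap ell :: "'a rel"
  assumes "AEC K" and "joint_embedding K" and "amalgamation K" and "no_maximal_models K"
    and "monster K kbar C"
    and "simple_independence_relation K kbar C ind"
    and "finite_witness_singletons K kbar C ind"
    and "is_LS K LS"
    and "is_kappa_ell K kbar C ind kap ell"
    and "Card_order \<mu>" and "Card_order lam" and "lam <o kbar"
    and "LS \<le>o \<mu>" and "\<mu> \<le>o lam"
    and "kap \<le>o \<mu>" and "cexp_less \<mu> ell =o \<mu>"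
  shows "NT K C \<mu> lam (cardSuc (ctwo ^c \<mu>)) \<le>o (lam ^c kap) +c (ctwo ^c \<mu>)"
proof -
  have LS: "LST_bound K LS" using \<open>is_LS K LS\<close> unfolding is_LS_def by blast
  have kap_ell: "local_character_pair K kbar C ind kap ell" "Field kap \<noteq> {}"
    using \<open>is_kappa_ell K kbar C ind kap ell\<close> unfolding is_kappa_ell_def by blast+
  have "cinfinite LS" using LS unfolding LST_bound_def by blast
  then have \<mu>: "Cinfinite \<mu>" using cinfinite_mono \<open>LS \<le>o \<mu>\<close> \<open>Card_order \<mu>\<close> by blast
  then have lam: "Cinfinite lam" using cinfinite_mono \<open>\<mu> \<le>o lam\<close> \<open>Card_order lam\<close> by blast
  have "\<mu> <o kbar" using \<open>\<mu> \<le>o lam\<close> \<open>lam <o kbar\<close> by (rule ordLeq_ordLess_trans)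
  then interpret simple_independence_cardinals K kbar C ind \<mu> LS kap ell
    using assms LS kap_ell(1) \<mu> by unfold_locales
  show ?thesis by (rule NT_ordLeq[OF lam kap_ell(2)])
qed

end
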